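(* Let $K$ be any field (of arbitrary characteristic). Then $$\mathrm{Aut}_{su}(K,2)\subseteq\langle \mathrm{PF}(K,2)\rangle_\circ .$$ In other words, every polynomial automorphism of the plane over $K$ of the form $F=\mathrm{Id}+H$, where $H=(H_1,H_2)\in K[X_1,X_2]^2$ has order of vanishing at the origin at least $2$ (i.e. all monomials occurring in $H_1,H_2$ have degree $\ge 2$), is a composition of finitely many Pascal finite automorphisms of the plane over $K$.
   Context: Let $K$ be a field, $X=(X_1,\dots,X_n)$ (here $n=2$). A polynomial map is a tuple $F=(F_1,\dots,F_n)\in K[X]^n$; it is invertible (a polynomial automorphism) if there is $G\in K[X]^n$ with $F\circ G=G\circ F=(X_1,\dots,X_n)$. Composition is functional: $(F\circ G)(X)=F(G(X))$. $J_F=(\partial F_i/\partial X_j)$ is the Jacobian matrix. For $P\in K[X]$ put $\sigma_F(P)=P\circ F$ and $\Delta_F(P)=P\circ F-P$. $F$ is Pascal finite if there is an integer $m\ge 1$ with $\Delta_F^m(X_i)=0$ for all $i=1,\dots,n$. $\mathrm{PF}(K,n)$ is the set of Pascal finite polynomial automorphisms in $K[X]^n$, and $\langle \mathrm{PF}(K,n)\rangle_\circ$ is the set of all finite compositions of elements of $\mathrm{PF}(K,n)$. $\mathrm{Aut}_{su}(K,n)$ is the set of polynomial automorphisms $F\in K[X]^n$ with $F(0)=0$ and $J_F(0)=\mathrm{Id}$. *)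

theory Defs
  imports "HOL-Analysis.Analysis" "HOL-Computational_Algebra.Polynomial"
begin

(* K[X_1, X_2] is rendered as K[X_1][X_2]: in a bpoly, X_1 is the variable of the inner
   (coefficient) polynomials and X_2 is the outer variable.  Indices have the two-element
   numeral type 2, whose elements are 1 and 2 (with 2 = 0). *)

type_synonym 'a bpoly = "'a poly poly"

type_synonym 'a polymap = "'a bpoly ^ 2"

definition bvar :: "2 \<Rightarrow> ('a::field) bpoly" where
  "bvar i = (if i = 1 then [:[:0, 1:]:] else [:0, 1:])"

definition bcoeff :: "('a::field) bpoly \<Rightarrow> nat \<Rightarrow> nat \<Rightarrow> 'a" where
  "bcoeff P a b = coeff (coeff P b) a"

definition beval :: "('a::field) bpoly \<Rightarrow> 'a ^ 2 \<Rightarrow> 'a" where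
  "beval P v = poly (poly P [:v $ 2:]) (v $ 1)"

(* coeff (coeff P b) a belongs to X_1^a X_2^b, so d/dX_1 acts on the coefficients. *)
definition bpderiv :: "2 \<Rightarrow> ('a::field) bpoly \<Rightarrow> 'a bpoly" where
  "bpderiv j P = (if j = 1 then map_poly pderiv P else pderiv P)"

(* P o F = P(F_1, F_2): each coefficient c in K[X_1] is first evaluated at F_1, the result at F_2. *)
definition bsubst :: "('a::field) bpoly \<Rightarrow> 'a polymap \<Rightarrow> 'a bpoly" where
  "bsubst P F = poly (map_poly (\<lambda>c. poly (map_poly (\<lambda>k. [:[:k:]:]) c) (F $ 1)) P) (F $ 2)"

definition pm_id :: "('a::field) polymap" where
  "pm_id = (\<chi> i. bvar i)"

definition pm_comp :: "('a::field) polymap \<Rightarrow> 'a polymap \<Rightarrow> 'a polymap" where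
  "pm_comp F G = (\<chi> i. bsubst (F $ i) G)"

definition pm_eval :: "('a::field) polymap \<Rightarrow> 'a ^ 2 \<Rightarrow> 'a ^ 2" where
  "pm_eval F v = (\<chi> i. beval (F $ i) v)"

definition pm_invertible :: "('a::field) polymap \<Rightarrow> bool" where
  "pm_invertible F \<longleftrightarrow> (\<exists>G. pm_comp F G = pm_id \<and> pm_comp G F = pm_id)"

definition jacobian_matrix :: "('a::field) polymap \<Rightarrow> 'a bpoly ^ 2 ^ 2" where
  "jacobian_matrix F = (\<chi> i j. bpderiv j (F $ i))"

definition jacobian_at :: "('a::field) polymap \<Rightarrow> 'a ^ 2 \<Rightarrow> 'a ^ 2 ^ 2" where
  "jacobian_at F v = (\<chi> i j. beval (jacobian_matrix F $ i $ j) v)"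

definition Aut_su :: "('a::field) polymap set" where
  "Aut_su = {F. pm_invertible F \<and> pm_eval F 0 = 0 \<and> jacobian_at F 0 = mat 1}"

definition pm_Delta :: "('a::field) polymap \<Rightarrow> 'a bpoly \<Rightarrow> 'a bpoly" where
  "pm_Delta F P = bsubst P F - P"

definition pascal_finite :: "('a::field) polymap \<Rightarrow> bool" where
  "pascal_finite F \<longleftrightarrow> (\<exists>m\<ge>1. \<forall>i. (pm_Delta F ^^ m) (bvar i) = 0)"

definition PF :: "('a::field) polymap set" where
  "PF = {F. pm_invertible F \<and> pascal_finite F}"

inductive_set comp_closure :: "('a::field) polymap set \<Rightarrow> 'a polymap set"
  for S :: "'a polymap set" where
  base: "F \<in> S \<Longrightarrow> F \<in> comp_closure S"
| step: "F \<in> S \<Longrightarrow> G \<in> comp_closure S \<Longrightarrow> pm_comp F G \<in> comp_closure S"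

definition vanishing_order_ge :: "nat \<Rightarrow> ('a::field) bpoly \<Rightarrow> bool" where
  "vanishing_order_ge d P \<longleftrightarrow> (\<forall>a b. bcoeff P a b \<noteq> 0 \<longrightarrow> d \<le> a + b)"

end

theory Submission
  imports Defs
begin

text \<open>
  The key point is the theorem of Jung and van der Kulk, proved here over an arbitrary field by
  counting dimensions. Let $F = (f,g)$ and $G = (p,q)$ be mutually inverse and let $b, a > 0$ be the
  degrees of $p, q$ in the second variable $v$; give $x$ weight $b$ and $y$ weight $a$. Comparing
  dimensions in $K[x,y]/(y)$, $K[x,y]/(x)$ and $K[x,y]/(f) \cong K[v]$ shows that $f$ has weighted
  degree exactly $ab$ and contains $x^a$ and $y^b$. Modulo a nonzero $P$ of $v$-degree less than
  $\min(a,b)$, the powers $x^j$ ($j < a$) are linearly dependent over $K[f]$, so $P$ divides some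
  $\sum_j d_j(f) x^j$, whose top weight is attained at a pure power of $x$; the same then holds for
  $P$, and likewise for $y$. Hence the weighted degree of $P$ is a multiple of both $a$ and $b$,
  which is so restrictive that the $f^i g^j$ with $j < \min(a,b)$ are too many unless $a \mid b$ or
  $b \mid a$. The leading coefficients in $v$ of $f(p,q) = u$ then yield an elementary map that
  lowers $a + b$.

  So $F$ is a product of elementary maps followed by $\mathrm{diag}(\delta, 1)$. Elementary maps are
  Pascal finite since $\Delta^2$ kills both variables, and they preserve the Jacobian determinant,
  so $\delta = 1$ when $J_F(0) = \mathrm{Id}$.
\<close>

section \<open>Substitution into bivariate polynomials and composition of polynomial maps\<close>

definition cst :: "'a::field \<Rightarrow> 'a bpoly" where "cst k = [:[:k:]:]"
definition vx :: "'a::field bpoly" where "vx = [:[:0, 1:]:]"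
definition vy :: "'a::field bpoly" where "vy = [:0, 1:]"
definition pm :: "'a::field bpoly \<Rightarrow> 'a bpoly \<Rightarrow> 'a polymap"
  where "pm P Q = (\<chi> i. if i = 1 then P else Q)"

lemma pm_nth [simp]: "pm P Q $ 1 = P" "pm P Q $ 2 = Q"
  by (simp_all add: pm_def)

lemma polymap_eqI: "F $ 1 = G $ 1 \<Longrightarrow> F $ 2 = G $ 2 \<Longrightarrow> F = (G :: 'a::field polymap)"
  by (simp add: vec_eq_iff forall_2)

lemma bvar_simps [simp]: "bvar 1 = vx" "bvar 2 = vy"
  by (simp_all add: bvar_def vx_def vy_def)

lemma pm_id_eq: "pm_id = pm vx vy"
  by (rule polymap_eqI) (simp_all add: pm_id_def)

lemma pm_comp_nth [simp]: "pm_comp F G $ i = bsubst (F $ i) G"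
  by (simp add: pm_comp_def)

lemma cst_simps [simp]: "cst 0 = 0" "cst 1 = 1" "cst (k + l) = cst k + cst l"
  "cst (k * l) = cst k * cst l" "cst (- k) = - cst k" "cst (k - l) = cst k - cst l"
  by (simp_all add: cst_def one_pCons)

lemma pCons_outer: "pCons c P = [:c:] + vy * (P :: 'a::field bpoly)"
  by (simp add: vy_def)

lemma pCons_inner: "[:pCons k c:] = cst k + vx * ([:c:] :: 'a::field bpoly)"
  by (simp add: vx_def cst_def)

text \<open>Constants, x and y generate K[x,y], so identities between ring homomorphisms need
  checking only there. Associativity of substitution and the Leibniz rule are obtained in this
  way.\<close>

lemma bpoly_induct [case_names cst add x y]:
  fixes P :: "'a::field bpoly"
  assumes "\<And>k. Q (cst k)" "\<And>A B. Q A \<Longrightarrow> Q B \<Longrightarrow> Q (A + B)"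
    "\<And>A. Q A \<Longrightarrow> Q (vx * A)" "\<And>A. Q A \<Longrightarrow> Q (vy * A)"
  shows "Q P"
proof -
  have c: "Q [:c:]" for c
  proof (induction c)
    case 0 then show ?case using assms(1)[of 0] by simp
  next
    case (pCons k c)
    then show ?case unfolding pCons_inner using assms by blast
  qed
  show ?thesis
  proof (induction P)
    case 0 then show ?case using assms(1)[of 0] by simp
  next
    case (pCons c P)
    then show ?case unfolding pCons_outer[of c P] using assms(2,4) c by blast
  qed
qed

definition isub :: "'a::field poly \<Rightarrow> 'a bpoly \<Rightarrow> 'a bpoly" where
  "isub c X = poly (map_poly cst c) X"

lemma isub_0 [simp]: "isub 0 X = 0"
  by (simp add: isub_def)

lemma isub_pCons [simp]: "isub (pCons k c) X = cst k + X * isub c X"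
  by (simp add: isub_def map_poly_pCons)

lemma isub_1 [simp]: "isub 1 X = 1"
  by (simp add: one_pCons)

lemma isub_add: "isub (c + d) X = isub c X + isub d X"
  by (induction c d rule: poly_induct2) (auto simp: algebra_simps)

lemma isub_smult: "isub (smult k c) X = cst k * isub c X"
  by (induction c) (auto simp: algebra_simps)

lemma isub_mult: "isub (c * d) X = isub c X * isub d X"
  by (induction c) (auto simp: algebra_simps isub_add isub_smult)

lemma bsubst_isub: "bsubst P F = poly (map_poly (\<lambda>c. isub c (F $ 1)) P) (F $ 2)"
  unfolding bsubst_def isub_def cst_def ..

lemma bsubst_0 [simp]: "bsubst 0 F = 0"
  by (simp add: bsubst_isub)

lemma bsubst_pCons: "bsubst (pCons c P) F = isub c (F $ 1) + F $ 2 * bsubst P F"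
  by (simp add: bsubst_isub map_poly_pCons)

lemma bsubst_add: "bsubst (P + Q) F = bsubst P F + bsubst Q F"
  by (induction P Q rule: poly_induct2) (auto simp: algebra_simps isub_add bsubst_pCons)

lemma bsubst_smult: "bsubst (smult c P) F = isub c (F $ 1) * bsubst P F"
  by (induction P) (auto simp: algebra_simps bsubst_pCons isub_mult)

lemma bsubst_mult: "bsubst (P * Q) F = bsubst P F * bsubst Q F"
  by (induction P) (auto simp: algebra_simps bsubst_add bsubst_smult bsubst_pCons)

lemma bsubst_cst [simp]: "bsubst (cst k) F = cst k"
  by (simp add: cst_def[of k] bsubst_pCons)

lemma bsubst_vx [simp]: "bsubst vx F = F $ 1"
  by (simp add: vx_def bsubst_pCons)

lemma bsubst_vy [simp]: "bsubst vy F = F $ 2"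
  by (simp add: vy_def bsubst_pCons)

lemma bsubst_1 [simp]: "bsubst 1 F = 1"
  using bsubst_cst[of 1 F] by simp

lemma bsubst_uminus: "bsubst (- P) F = - bsubst P F"
  using bsubst_add[of P "- P" F] by (simp add: add_eq_0_iff)

lemma bsubst_diff: "bsubst (P - Q) F = bsubst P F - bsubst Q F"
  using bsubst_add[of P "- Q" F] by (simp add: bsubst_uminus)

lemma bsubst_power: "bsubst (P ^ n) F = bsubst P F ^ n"
  by (induction n) (auto simp: bsubst_mult)

lemma bsubst_sum: "bsubst (sum h S) F = (\<Sum>i\<in>S. bsubst (h i) F)"
  by (induction S rule: infinite_finite_induct) (auto simp: bsubst_add)

lemmas bsubst_hom = bsubst_add bsubst_mult bsubst_diff bsubst_uminus bsubst_power bsubst_sum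

lemma bsubst_bsubst: "bsubst (bsubst P F) G = bsubst P (pm_comp F G)"
  by (induction P rule: bpoly_induct) (auto simp: bsubst_hom)

lemma bsubst_id [simp]: "bsubst P pm_id = P"
  by (induction P rule: bpoly_induct) (auto simp: bsubst_hom pm_id_eq)

lemma pm_comp_assoc: "pm_comp (pm_comp F G) H = pm_comp F (pm_comp G H)"
  by (rule polymap_eqI) (simp_all add: bsubst_bsubst)

lemma pm_comp_id [simp]: "pm_comp F pm_id = F" "pm_comp pm_id F = F"
  by (rule polymap_eqI; simp; simp add: pm_id_eq)+

lemma bsubst_isub_comp: "bsubst (isub c X) F = isub c (bsubst X F)"
  by (induction c) (auto simp: bsubst_hom)

lemma isub_vx: "isub c vx = [:c:]"
  by (induction c) (auto simp: vx_def cst_def)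

lemma bsubst_inner: "bsubst [:c:] F = isub c (F $ 1)"
  by (simp add: bsubst_pCons)

section \<open>Coefficients of monomials, and linear systems over integral domains\<close>

lemma bcoeff_add: "bcoeff (P + Q) i j = bcoeff P i j + bcoeff Q i j"
  by (simp add: bcoeff_def)

lemma bcoeff_sum: "bcoeff (sum h S) i j = (\<Sum>s\<in>S. bcoeff (h s) i j)"
  by (simp add: bcoeff_def coeff_sum)

lemma bcoeff_cst_mult: "bcoeff (cst k * P) i j = k * bcoeff P i j"
  by (simp add: bcoeff_def cst_def)

lemma bpoly_eqI: "(\<And>i j. bcoeff P i j = bcoeff Q i j) \<Longrightarrow> P = Q"
  by (simp add: bcoeff_def poly_eq_iff)

lemma vx_power: "vx ^ i = [:monom 1 i:]"
  by (induction i) (auto simp: vx_def monom_Suc one_pCons)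

lemma vy_power: "vy ^ j = monom 1 j"
  by (induction j) (auto simp: vy_def monom_Suc simp flip: one_pCons)

lemma bcoeff_monomial:
  "bcoeff (cst k * vx ^ i * vy ^ j) i' j' = (if i' = i \<and> j' = j then k else 0)"
  by (auto simp: bcoeff_def vx_power vy_power cst_def smult_monom)

lemma linear_dependence:
  fixes r :: "'i \<Rightarrow> nat \<Rightarrow> 'r::idom"
  assumes "finite I" "s < card I"
  shows "\<exists>d. (\<exists>i\<in>I. d i \<noteq> 0) \<and> (\<forall>k<s. (\<Sum>i\<in>I. d i * r i k) = 0)"
  using assms
proof (induction s arbitrary: I r)
  case 0
  then have "I \<noteq> {}" by auto
  then show ?case by (intro exI[of _ "\<lambda>_. 1"]) auto
next
  case (Suc s)
  show ?case
  proof (cases "\<forall>i\<in>I. r i s = 0")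
    case True
    obtain d where d: "\<exists>i\<in>I. d i \<noteq> 0" "\<forall>k<s. (\<Sum>i\<in>I. d i * r i k) = 0"
      using Suc.IH[of I r] Suc.prems by auto
    have "(\<Sum>i\<in>I. d i * r i k) = 0" if "k < Suc s" for k
      using that d True by (cases "k = s") auto
    then show ?thesis using d(1) by blast
  next
    case False
    then obtain i0 where i0: "i0 \<in> I" "r i0 s \<noteq> 0" by auto
    define J where "J = I - {i0}"
    \<comment> \<open>Cross-multiplication with the pivot \<open>r i0 s\<close> makes every
      \<open>r' i\<close> vanish at \<open>s\<close>.\<close>
    define r' where "r' i k = r i0 s * r i k - r i s * r i0 k" for i k
    have J: "finite J" "s < card J" using Suc.prems i0 by (auto simp: J_def)
    obtain e where e: "\<exists>i\<in>J. e i \<noteq> 0" "\<forall>k<s. (\<Sum>i\<in>J. e i * r' i k) = 0"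
      using Suc.IH[OF J, of r'] by auto
    \<comment> \<open>The coefficients of the \<open>r i\<close> after expanding each
      \<open>r' i\<close> in the relation given by \<open>e\<close>.\<close>
    define d where "d i = (if i = i0 then - (\<Sum>i\<in>J. e i * r i s) else r i0 s * e i)" for i
    have key: "(\<Sum>i\<in>I. d i * r i k) = (\<Sum>i\<in>J. e i * r' i k)" for k
    proof -
      have "(\<Sum>i\<in>I. d i * r i k) = d i0 * r i0 k + (\<Sum>i\<in>J. d i * r i k)"
        using Suc.prems(1) i0(1) unfolding J_def by (rule sum.remove)
      also have "(\<Sum>i\<in>J. d i * r i k) = (\<Sum>i\<in>J. r i0 s * e i * r i k)"
        by (rule sum.cong) (auto simp: J_def d_def)
      also have "d i0 * r i0 k = - (\<Sum>i\<in>J. e i * r i s * r i0 k)"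
        by (simp add: d_def sum_distrib_right)
      finally show ?thesis
        by (simp add: r'_def algebra_simps sum_subtractf)
    qed
    have "(\<Sum>i\<in>I. d i * r i k) = 0" if "k < Suc s" for k
    proof (cases "k = s")
      case True
      then show ?thesis unfolding key by (simp add: r'_def mult.commute)
    next
      case False
      then show ?thesis using that e(2) key by simp
    qed
    moreover have "\<exists>i\<in>I. d i \<noteq> 0"
      using e(1) i0 by (auto simp: d_def J_def)
    ultimately show ?thesis by blast
  qed
qed

lemma degree_sum_distinct:
  fixes T :: "'i \<Rightarrow> 'r::comm_ring_1 poly"
  assumes "finite I" "i0 \<in> I" "T i0 \<noteq> 0"
    and less: "\<And>i. i \<in> I \<Longrightarrow> i \<noteq> i0 \<Longrightarrow> T i \<noteq> 0 \<Longrightarrow> degree (T i) < degree (T i0)"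
  shows "(\<Sum>i\<in>I. T i) \<noteq> 0" "degree (T i0) \<le> degree (\<Sum>i\<in>I. T i)"
proof -
  have "coeff (\<Sum>i\<in>I. T i) (degree (T i0)) = coeff (T i0) (degree (T i0))
      + (\<Sum>i\<in>I - {i0}. coeff (T i) (degree (T i0)))"
    by (simp add: coeff_sum sum.remove[OF assms(1,2)])
  also have "(\<Sum>i\<in>I - {i0}. coeff (T i) (degree (T i0))) = 0"
    by (rule sum.neutral) (metis DiffE coeff_0 coeff_eq_0 insertCI less)
  finally have *: "coeff (\<Sum>i\<in>I. T i) (degree (T i0)) \<noteq> 0"
    using assms(3) by simp
  then show "(\<Sum>i\<in>I. T i) \<noteq> 0" "degree (T i0) \<le> degree (\<Sum>i\<in>I. T i)"
    by (auto intro: le_degree)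
qed

subsection \<open>Weighted degrees\<close>

text \<open>Later \<open>b\<close> and \<open>a\<close> are the degrees in v of the components p and
  q of the inverse map, so that the weight of x^i y^j bounds the degree of p^i q^j. Stating a bound
  spares the zero polynomial a special case.\<close>

definition wle :: "nat \<Rightarrow> nat \<Rightarrow> nat \<Rightarrow> 'a::field bpoly \<Rightarrow> bool" where
  "wle b a t P \<longleftrightarrow> (\<forall>i j. bcoeff P i j \<noteq> 0 \<longrightarrow> b * i + a * j \<le> t)"

lemma bcoeff_mult:
  "bcoeff (P * Q) i j = (\<Sum>l\<le>j. \<Sum>k\<le>i. bcoeff P k l * bcoeff Q (i - k) (j - l))"
  by (simp add: bcoeff_def coeff_mult coeff_sum)

lemma bcoeff_0 [simp]: "bcoeff 0 i j = 0"
  by (simp add: bcoeff_def)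

lemma bcoeff_cst: "bcoeff (cst k) i j = (if i = 0 \<and> j = 0 then k else 0)"
  using bcoeff_monomial[of k 0 0 i j] by simp

lemma bcoeff_vx: "bcoeff vx i j = (if i = 1 \<and> j = 0 then 1 else 0)"
  using bcoeff_monomial[of 1 1 0 i j] by simp

lemma bcoeff_vy: "bcoeff vy i j = (if i = 0 \<and> j = 1 then 1 else 0)"
  using bcoeff_monomial[of 1 0 1 i j] by simp

lemma bcoeff_nonzero_ex: "P \<noteq> 0 \<Longrightarrow> \<exists>i j. bcoeff P i j \<noteq> 0"
  using bpoly_eqI[of P 0] by auto

lemma bcoeff_degree: "bcoeff P i j \<noteq> 0 \<Longrightarrow> j \<le> degree P"
  by (metis bcoeff_def coeff_0 le_degree)

lemma wle_mono: "wle b a t P \<Longrightarrow> t \<le> t' \<Longrightarrow> wle b a t' P"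
  by (force simp: wle_def)

lemma wle_0 [simp]: "wle b a t 0"
  by (simp add: wle_def)

lemma wle_cst [simp]: "wle b a t (cst k)"
  by (simp add: wle_def bcoeff_cst)

lemma wle_vx [simp]: "wle b a b vx" and wle_vy [simp]: "wle b a a vy"
  by (auto simp add: wle_def bcoeff_vx bcoeff_vy split: if_splits)

lemma wle_add: "wle b a t P \<Longrightarrow> wle b a t Q \<Longrightarrow> wle b a t (P + Q)"
  unfolding wle_def bcoeff_add by (metis add.right_neutral)

lemma wle_sum: "(\<And>i. i \<in> S \<Longrightarrow> wle b a t (h i)) \<Longrightarrow> wle b a t (sum h S)"
  by (induction S rule: infinite_finite_induct) (auto intro: wle_add)

lemma weight_split:
  "k \<le> i \<Longrightarrow> l \<le> j \<Longrightarrow> (b * k + a * l) + (b * (i - k) + a * (j - l)) = b * i + a * (j :: nat)"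
  by (auto simp: le_iff_add algebra_simps)

lemma wle_mult:
  assumes "wle b a s P" "wle b a t Q"
  shows "wle b a (s + t) (P * Q)"
  unfolding wle_def
proof (intro allI impI)
  fix i j assume "bcoeff (P * Q) i j \<noteq> 0"
  then obtain l where l: "l \<le> j" "(\<Sum>k\<le>i. bcoeff P k l * bcoeff Q (i - k) (j - l)) \<noteq> 0"
    unfolding bcoeff_mult by (metis (no_types, lifting) atMost_iff sum.not_neutral_contains_not_neutral)
  then obtain k where k: "k \<le> i" "bcoeff P k l * bcoeff Q (i - k) (j - l) \<noteq> 0"
    by (metis (no_types, lifting) atMost_iff sum.not_neutral_contains_not_neutral)
  then have "b * k + a * l \<le> s" "b * (i - k) + a * (j - l) \<le> t"
    using assms by (auto simp: wle_def)
  moreover have "b * i + a * j = (b * k + a * l) + (b * (i - k) + a * (j - l))"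
    using weight_split l(1) k(1) by presburger
  ultimately show "b * i + a * j \<le> s + t" by linarith
qed

lemma wle_power: "wle b a t P \<Longrightarrow> wle b a (n * t) (P ^ n)"
proof (induction n)
  case 0
  then show ?case using wle_cst[of b a 0 1] by simp
next
  case (Suc n)
  then show ?case using wle_mult[of b a t P "n * t"] by simp
qed

lemma wle_ex: "\<exists>t. wle b a t P"
proof (induction P rule: bpoly_induct)
  case (add A B)
  then obtain s t where "wle b a s A" "wle b a t B" by auto
  then have "wle b a (max s t) (A + B)" by (intro wle_add) (auto intro: wle_mono)
  then show ?case by blast
next
  case (x A)
  then show ?case using wle_mult[OF wle_vx] by blast
next
  case (y A)
  then show ?case using wle_mult[OF wle_vy] by blast
qed (use wle_cst in blast)

text \<open>The leading monomial for the order that compares weights first and breaks ties by the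
  exponent of y.\<close>

definition wtop :: "nat \<Rightarrow> nat \<Rightarrow> 'a::field bpoly \<Rightarrow> nat \<Rightarrow> nat \<Rightarrow> bool" where
  "wtop b a P i j \<longleftrightarrow> bcoeff P i j \<noteq> 0 \<and> wle b a (b * i + a * j) P
    \<and> (\<forall>i' j'. bcoeff P i' j' \<noteq> 0 \<longrightarrow> b * i' + a * j' = b * i + a * j \<longrightarrow> j' \<le> j)"

lemma wtop_ex:
  assumes "P \<noteq> 0"
  shows "\<exists>i j. wtop b a P i j"
proof -
  define T where "T = {t. \<exists>i j. bcoeff P i j \<noteq> 0 \<and> t = b * i + a * j}"
  obtain t where "wle b a t P" using wle_ex by blast
  then have "T \<subseteq> {..t}" by (auto simp: T_def wle_def)
  then have fin: "finite T" using finite_subset by blast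
  have "T \<noteq> {}" using bcoeff_nonzero_ex[OF assms] by (auto simp: T_def)
  define m where "m = Max T"
  have M: "m \<in> T" unfolding m_def using fin \<open>T \<noteq> {}\<close> by (rule Max_in)
  have max: "wle b a m P"
    unfolding wle_def
  proof (intro allI impI)
    fix k l assume "bcoeff P k l \<noteq> 0"
    then have "b * k + a * l \<in> T" by (auto simp: T_def)
    then show "b * k + a * l \<le> m" unfolding m_def using fin by simp
  qed
  define J where "J = {j. \<exists>i. bcoeff P i j \<noteq> 0 \<and> b * i + a * j = m}"
  have "J \<subseteq> {..degree P}" by (auto simp: J_def bcoeff_degree)
  then have finJ: "finite J" using finite_subset by blast
  have J: "J \<noteq> {}" using M by (auto simp: J_def T_def)
  define j where "j = Max J"
  have "j \<in> J" unfolding j_def using finJ J by (rule Max_in)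
  then obtain i where i: "bcoeff P i j \<noteq> 0" "b * i + a * j = m" by (auto simp: J_def)
  have "j' \<le> j" if "bcoeff P i' j' \<noteq> 0" "b * i' + a * j' = m" for i' j'
    unfolding j_def using that by (intro Max_ge[OF finJ]) (auto simp: J_def)
  then show ?thesis unfolding wtop_def using i max by blast
qed

text \<open>A pair of monomials with this product must have top weight on both sides, and then top
  y-exponent on both sides, so only one pair contributes. By \<open>0 < b\<close>, weight and
  y-exponent determine the x-exponent.\<close>

lemma bcoeff_mult_wtop:
  assumes b: "0 < b" and P: "wtop b a P i0 j0" and Q: "wtop b a Q i1 j1"
  shows "bcoeff (P * Q) (i0 + i1) (j0 + j1) = bcoeff P i0 j0 * bcoeff Q i1 j1"
proof -
  let ?i = "i0 + i1" and ?j = "j0 + j1"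
  let ?T = "\<lambda>l k. bcoeff P k l * bcoeff Q (?i - k) (?j - l)"
  have zero: "?T l k = 0" if "l \<le> ?j" "k \<le> ?i" "\<not> (l = j0 \<and> k = i0)" for l k
  proof (rule ccontr)
    assume "?T l k \<noteq> 0"
    then have nz: "bcoeff P k l \<noteq> 0" "bcoeff Q (?i - k) (?j - l) \<noteq> 0" by auto
    then have le: "b * k + a * l \<le> b * i0 + a * j0"
        "b * (?i - k) + a * (?j - l) \<le> b * i1 + a * j1"
      using P Q by (auto simp: wtop_def wle_def)
    have "(b * k + a * l) + (b * (?i - k) + a * (?j - l)) = b * ?i + a * ?j"
      using that by (intro weight_split)
    then have eq: "b * k + a * l = b * i0 + a * j0"
        "b * (?i - k) + a * (?j - l) = b * i1 + a * j1"
      using le by (auto simp: algebra_simps)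
    then have "l \<le> j0" "?j - l \<le> j1" using P Q nz unfolding wtop_def by blast+
    then have "l = j0" using that by linarith
    then have "k = i0" using eq(1) b by simp
    then show False using that \<open>l = j0\<close> by simp
  qed
  have "(\<Sum>k\<le>?i. ?T l k) = (if l = j0 then ?T j0 i0 else 0)" if "l \<le> ?j" for l
  proof (cases "l = j0")
    case True
    have "(\<Sum>k\<le>?i. ?T j0 k) = (\<Sum>k\<le>?i. if k = i0 then ?T j0 i0 else 0)"
    proof (rule sum.cong[OF refl])
      fix k assume "k \<in> {..?i}"
      then show "?T j0 k = (if k = i0 then ?T j0 i0 else 0)"
        using zero[of j0 k] by (cases "k = i0") auto
    qed
    then show ?thesis using True by simp
  next
    case False
    then show ?thesis using zero that by (auto intro!: sum.neutral)
  qed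
  then have "bcoeff (P * Q) ?i ?j = (\<Sum>l\<le>?j. if l = j0 then ?T j0 i0 else 0)"
    unfolding bcoeff_mult by (intro sum.cong) auto
  then show ?thesis by simp
qed

text \<open>On the zero polynomial this takes the value 0.\<close>

definition wd :: "nat \<Rightarrow> nat \<Rightarrow> 'a::field bpoly \<Rightarrow> nat" where
  "wd b a P = (LEAST t. wle b a t P)"

lemma wle_wd: "wle b a (wd b a P) P"
  unfolding wd_def using wle_ex by (rule LeastI_ex)

lemma wd_le: "wle b a t P \<Longrightarrow> wd b a P \<le> t"
  unfolding wd_def by (rule Least_le)

lemma wd_wtop: "wtop b a P i j \<Longrightarrow> wd b a P = b * i + a * j"
  using wle_wd[of b a P] wd_le[of b a _ P] by (auto simp: wtop_def wle_def intro!: antisym)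

text \<open>Leading monomials multiply, and K has no zero divisors. This exact additivity later lets
  an equality for a product pass to its factors.\<close>

lemma wd_mult:
  assumes "0 < b" "P \<noteq> 0" "Q \<noteq> 0"
  shows "wd b a (P * Q) = wd b a P + wd b a Q"
proof (rule antisym)
  show "wd b a (P * Q) \<le> wd b a P + wd b a Q"
    by (intro wd_le wle_mult wle_wd)
  obtain i j k l where P: "wtop b a P i j" and Q: "wtop b a Q k l"
    using wtop_ex assms by metis
  have "bcoeff (P * Q) (i + k) (j + l) \<noteq> 0"
    using bcoeff_mult_wtop[OF assms(1) P Q] P Q by (simp add: wtop_def)
  then have "b * (i + k) + a * (j + l) \<le> wd b a (P * Q)"
    using wle_wd[of b a "P * Q"] by (simp add: wle_def)
  then show "wd b a P + wd b a Q \<le> wd b a (P * Q)"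
    using wd_wtop[OF P] wd_wtop[OF Q] by (simp add: algebra_simps)
qed

definition bcomb :: "(nat \<times> nat \<Rightarrow> 'a::field) \<Rightarrow> (nat \<times> nat) set \<Rightarrow> 'a bpoly" where
  "bcomb d I = (\<Sum>z\<in>I. cst (d z) * vx ^ fst z * vy ^ snd z)"

lemma bcoeff_bcomb:
  assumes "finite I"
  shows "bcoeff (bcomb d I) i j = (if (i, j) \<in> I then d (i, j) else 0)"
proof -
  have "bcoeff (bcomb d I) i j = (\<Sum>z\<in>I. if z = (i, j) then d (i, j) else 0)"
    unfolding bcomb_def bcoeff_sum bcoeff_monomial by (rule sum.cong) auto
  then show ?thesis using assms by simp
qed

lemma bcomb_nonzero: "finite I \<Longrightarrow> \<exists>z\<in>I. d z \<noteq> 0 \<Longrightarrow> bcomb d I \<noteq> 0"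
  using bcoeff_bcomb[of I d] by (metis bcoeff_0 surj_pair)

lemma bcomb_bcoeff:
  assumes "finite I" "\<And>i j. bcoeff P i j \<noteq> 0 \<Longrightarrow> (i, j) \<in> I"
  shows "bcomb (\<lambda>z. bcoeff P (fst z) (snd z)) I = P"
  using assms by (intro bpoly_eqI) (auto simp: bcoeff_bcomb)

lemma bsubst_bcomb: "bsubst (bcomb d I) F = (\<Sum>z\<in>I. cst (d z) * (F $ 1) ^ fst z * (F $ 2) ^ snd z)"
  by (simp add: bcomb_def bsubst_hom)

lemma degree_bcomb:
  assumes "finite I" "\<And>i j. (i, j) \<in> I \<Longrightarrow> j < n" "bcomb d I \<noteq> 0"
  shows "degree (bcomb d I) < n"
proof -
  have "coeff (bcomb d I) (degree (bcomb d I)) \<noteq> 0" using assms(3) by simp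
  then obtain i where "bcoeff (bcomb d I) i (degree (bcomb d I)) \<noteq> 0"
    unfolding bcoeff_def by (meson leading_coeff_neq_0)
  then show ?thesis
    using assms(2)[of i] bcoeff_bcomb[OF assms(1), of d i] by (auto split: if_splits)
qed

lemma degree_power_mult_le:
  "degree ((A :: 'r::comm_semiring_1 poly) ^ i * B ^ j) \<le> degree A * i + degree B * j"
  using degree_mult_le[of "A ^ i" "B ^ j"] degree_power_le[of A i] degree_power_le[of B j] by linarith

section \<open>Restriction to the coordinate axes, by K-algebra homomorphisms into polynomials in
  one variable\<close>

locale restriction =
  fixes \<rho> :: "'a::field bpoly \<Rightarrow> 'a poly"
  assumes rho_add: "\<rho> (P + Q) = \<rho> P + \<rho> Q"
    and rho_mult: "\<rho> (P * Q) = \<rho> P * \<rho> Q"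
    and rho_cst: "\<rho> (cst k) = [:k:]"
begin

lemma rho_0 [simp]: "\<rho> 0 = 0"
  using rho_cst[of 0] by simp

lemma rho_sum: "\<rho> (sum h S) = (\<Sum>i\<in>S. \<rho> (h i))"
  by (induction S rule: infinite_finite_induct) (auto simp: rho_add)

lemma rho_power: "\<rho> (P ^ n) = \<rho> P ^ n"
  using rho_cst[of 1] by (induction n) (auto simp: rho_mult simp flip: one_pCons)

lemma rho_isub: "\<rho> (isub c X) = pcompose c (\<rho> X)"
  by (induction c) (auto simp: rho_add rho_mult rho_cst pcompose_pCons)

lemma rho_bcomb:
  "\<rho> (bsubst (bcomb d I) F) = (\<Sum>z\<in>I. smult (d z) (\<rho> (F $ 1) ^ fst z * \<rho> (F $ 2) ^ snd z))"
  by (simp add: bsubst_bcomb rho_sum rho_mult rho_power rho_cst)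

end

text \<open>\<open>restx\<close> is reduction modulo y and \<open>resty\<close> reduction modulo x;
  their degrees detect the highest pure powers of x and of y.\<close>

definition restx :: "'a::field bpoly \<Rightarrow> 'a poly" where "restx P = coeff P 0"
definition resty :: "'a::field bpoly \<Rightarrow> 'a poly" where "resty P = map_poly (\<lambda>c. coeff c 0) P"

lemma coeff_restx: "coeff (restx P) i = bcoeff P i 0"
  by (simp add: restx_def bcoeff_def)

lemma coeff_resty: "coeff (resty P) j = bcoeff P 0 j"
  by (simp add: resty_def bcoeff_def coeff_map_poly)

lemma restriction_restx: "restriction restx"
  by standard (auto simp: restx_def cst_def coeff_mult)

lemma restriction_resty: "restriction resty"
proof
  show "resty (P + Q) = resty P + resty Q" for P Q :: "'a bpoly"
    by (simp add: poly_eq_iff coeff_resty bcoeff_add)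
  show "resty (P * Q) = resty P * resty Q" for P Q :: "'a bpoly"
    by (simp add: poly_eq_iff coeff_resty bcoeff_mult coeff_mult)
  show "resty (cst k) = [:k:]" for k :: 'a
    by (simp add: resty_def cst_def map_poly_pCons)
qed

lemma restx_kernel: "restx P = 0 \<Longrightarrow> \<exists>B. P = vy * B"
  by (cases P) (auto simp: restx_def vy_def)

lemma resty_kernel: "resty P = 0 \<Longrightarrow> \<exists>B. P = vx * B"
proof (induction P)
  case 0
  then show ?case by (intro exI[of _ 0]) simp
next
  case (pCons c P)
  then have c: "coeff c 0 = 0" and "resty P = 0"
    by (auto simp: resty_def map_poly_pCons split: if_splits)
  then obtain B where "P = vx * B" using pCons by auto
  moreover obtain c' where "c = pCons 0 c'" using c by (cases c) auto
  then have "[:c:] = vx * [:c':]" by (simp add: vx_def)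
  ultimately have "pCons c P = vx * [:c':] + vy * (vx * B)"
    using pCons_outer[of c P] by (simp only:)
  also have "\<dots> = vx * ([:c':] + vy * B)"
    by (simp only: distrib_left mult.left_commute)
  finally have "pCons c P = vx * ([:c':] + vy * B)" .
  then show ?case by blast
qed

lemma degree_restx:
  assumes "wle b a t P" "restx P \<noteq> 0"
  shows "b * degree (restx P) \<le> t"
proof -
  have "bcoeff P (degree (restx P)) 0 \<noteq> 0"
    using assms(2) by (simp flip: coeff_restx)
  then show ?thesis using assms(1) by (fastforce simp: wle_def)
qed

lemma degree_resty:
  assumes "wle b a t P" "resty P \<noteq> 0"
  shows "a * degree (resty P) \<le> t"
proof -
  have "bcoeff P 0 (degree (resty P)) \<noteq> 0"
    using assms(2) by (simp flip: coeff_resty)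
  then show ?thesis using assms(1) by (fastforce simp: wle_def)
qed

subsection \<open>Divisibility of the degrees\<close>

lemma wle_isub: "wle b a t X \<Longrightarrow> wle b a (degree c * t) (isub c X)"
proof (induction c)
  case (pCons k c)
  show ?case
  proof (cases "c = 0")
    case False
    then have "wle b a (t + degree c * t) (X * isub c X)"
      using pCons by (intro wle_mult) auto
    then show ?thesis using False by (auto intro: wle_add)
  qed auto
qed simp

lemma div_gcd_dvd_of_dvd_mult: "a dvd b * c \<Longrightarrow> 0 < a \<Longrightarrow> a div gcd a b dvd (c :: nat)"
proof -
  assume "a dvd b * c" "0 < a"
  then have "(a div gcd a b) * gcd a b dvd ((b div gcd a b) * c) * gcd a b"
    by (simp add: mult.commute mult.left_commute)
  then have "a div gcd a b dvd (b div gcd a b) * c"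
    using \<open>0 < a\<close> by (subst (asm) dvd_times_right_cancel_iff) auto
  then show ?thesis
    using div_gcd_coprime[of a b] \<open>0 < a\<close> by (simp add: coprime_dvd_mult_right_iff)
qed

text \<open>Write F = (f,g) and G = (p,q). Substituting G expresses a polynomial in the coordinates
  u = f and v = g, so divisibility by f turns into divisibility by u. On that side
  \<open>degree\<close> is the degree in v.\<close>

locale inverse_pair =
  fixes F G :: "'a::field polymap"
  assumes FG: "pm_comp F G = pm_id" and GF: "pm_comp G F = pm_id"
begin

lemma bsubst_GF [simp]: "bsubst (bsubst P G) F = P"
  by (simp add: bsubst_bsubst GF)

lemma bsubst_FG [simp]: "bsubst (bsubst P F) G = P"
  by (simp add: bsubst_bsubst FG)

lemma bsubst_F1 [simp]: "bsubst (F $ 1) G = vx" and bsubst_F2 [simp]: "bsubst (F $ 2) G = vy"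
  using bsubst_FG[of vx] bsubst_FG[of vy] by simp_all

lemma bsubst_G_eq_0 [simp]: "bsubst P G = 0 \<longleftrightarrow> P = 0"
  by (metis bsubst_0 bsubst_GF)

lemma bsubst_F_eq_0 [simp]: "bsubst P F = 0 \<longleftrightarrow> P = 0"
  by (metis bsubst_0 bsubst_FG)

lemma F1_nonzero: "F $ 1 \<noteq> 0"
proof
  assume "F $ 1 = 0"
  then have "vx = (0 :: 'a bpoly)" using bsubst_F1 by simp
  then show False by (simp add: vx_def)
qed

text \<open>If the restriction of f had degree below n, the degree of z(p,q), then the products f^i
  g^j with j < n would be dependent modulo z. So z would divide some nonzero H(f,g), and z(p,q)
  would divide H, whose v-degree is below n.\<close>

lemma degree_restriction_ge:
  assumes "restriction \<rho>" and kernel: "\<And>P. \<rho> P = 0 \<Longrightarrow> \<exists>B. P = z * B"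
  shows "degree (bsubst z G) \<le> degree (\<rho> (F $ 1))"
proof (rule ccontr)
  assume neg: "\<not> ?thesis"
  interpret restriction \<rho> by fact
  define n where "n = degree (bsubst z G)"
  define A where "A = degree (\<rho> (F $ 1))"
  define B where "B = degree (\<rho> (F $ 2))"
  have An: "Suc A \<le> n" using neg by (simp add: n_def A_def)
  \<comment> \<open>Large enough that n B + 1 < L; together with A < n this makes the L n products
    outnumber the s coefficients.\<close>
  define L where "L = n * B + 2"
  define s where "s = A * L + n * B + 1"
  define I where "I = {..<L} \<times> {..<n}"
  define T where "T z = \<rho> (F $ 1) ^ fst z * \<rho> (F $ 2) ^ snd z" for z :: "nat \<times> nat"
  have deg: "degree (T z) < s" if "z \<in> I" for z
  proof -
    have "degree (T z) \<le> A * fst z + B * snd z"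
      unfolding T_def A_def B_def by (rule degree_power_mult_le)
    also have "A * fst z \<le> A * L" using that by (auto simp: I_def)
    also have "B * snd z \<le> n * B" using that by (auto simp: I_def)
    finally show ?thesis by (simp add: s_def)
  qed
  have "s < L + A * L" by (simp add: s_def L_def)
  also have "\<dots> \<le> L * n" using mult_le_mono2[OF An, of L] by (simp add: algebra_simps)
  also have "L * n = card I" by (simp add: I_def card_cartesian_product)
  finally have "s < card I" .
  moreover have finI: "finite I" by (simp add: I_def)
  ultimately obtain d where d: "\<exists>z\<in>I. d z \<noteq> 0" "\<forall>k<s. (\<Sum>z\<in>I. d z * coeff (T z) k) = 0"
    using linear_dependence[of I s "\<lambda>z. coeff (T z)"] by auto
  define H where "H = bcomb d I"
  have "H \<noteq> 0" using d(1) finI bcomb_nonzero unfolding H_def by blast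
  have "\<rho> (bsubst H F) = 0"
  proof (rule poly_eqI)
    fix k
    have "coeff (\<rho> (bsubst H F)) k = (\<Sum>z\<in>I. d z * coeff (T z) k)"
      by (simp add: H_def rho_bcomb coeff_sum T_def)
    also have "\<dots> = 0"
    proof (cases "k < s")
      case False
      then have "coeff (T z) k = 0" if "z \<in> I" for z
        using deg[OF that] by (intro coeff_eq_0) simp
      then show ?thesis by simp
    qed (use d(2) in blast)
    finally show "coeff (\<rho> (bsubst H F)) k = coeff 0 k" by simp
  qed
  then obtain C where C: "bsubst H F = z * C" using kernel by blast
  then have "H = bsubst z G * bsubst C G"
    using bsubst_FG[of H] by (simp add: bsubst_hom)
  then have "n \<le> degree H"
    using \<open>H \<noteq> 0\<close> by (auto simp: degree_mult_eq n_def)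
  moreover have "degree H < n"
    unfolding H_def using finI \<open>H \<noteq> 0\<close> by (intro degree_bcomb) (auto simp: I_def H_def)
  ultimately show False by simp
qed

text \<open>
  Otherwise take a monomial of $f$ of top weight and, among those, of top degree in $y$. The
  monomials which it does not divide remain independent modulo $f$, but there are more of them than
  the degrees in $K[v] \cong K[x,y]/(f)$ allow.
\<close>

lemma wle_F1:
  assumes b: "b = degree (G $ 1)" "0 < b" and a: "a = degree (G $ 2)"
  shows "wle b a (a * b) (F $ 1)"
proof (rule ccontr)
  assume neg: "\<not> ?thesis"
  obtain i0 j0 where top: "wtop b a (F $ 1) i0 j0" using wtop_ex[OF F1_nonzero] by blast
  define t where "t = b * i0 + a * j0"
  have t: "a * b < t"
    using neg top wle_mono[of b a t "F $ 1" "a * b"] by (force simp: wtop_def t_def)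
  define K where "K = t + 2"
  define s where "s = t + a * b * K + 1"
  \<comment> \<open>Exponents of monomials not divisible by the leading monomial of f, taken from
    two strips. There are K t of them, while the degrees in v stay below \<open>s\<close>; as a b <
    t, the choice K = t + 2 gives s < K t.\<close>
  define I where "I = {..<a * K} \<times> {..<j0} \<union> {..<i0} \<times> {j0..<j0 + b * K}"
  have finI: "finite I" by (simp add: I_def)
  have "card I = a * K * j0 + i0 * (b * K)"
    unfolding I_def by (subst card_Un_disjoint) (auto simp: card_cartesian_product)
  also have "\<dots> = K * t" by (simp add: t_def algebra_simps)
  finally have card: "card I = K * t" .
  have "s < K * (a * b + 1)" by (simp add: s_def K_def algebra_simps)
  also have "\<dots> \<le> K * t" using t by (intro mult_le_mono2) simp
  finally have sI: "s < card I" using card by simp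
  define T where "T z = (G $ 1) ^ fst z * (G $ 2) ^ snd z" for z :: "nat \<times> nat"
  have deg: "degree (T z) < s" if "z \<in> I" for z
  proof -
    have "degree (T z) \<le> b * fst z + a * snd z"
      unfolding T_def a b by (rule degree_power_mult_le)
    also have "\<dots> \<le> t + a * b * K"
      using that unfolding I_def
    proof
      assume "z \<in> {..<a * K} \<times> {..<j0}"
      then have "fst z \<le> a * K" "snd z \<le> j0" by auto
      then have "b * fst z \<le> b * (a * K)" "a * snd z \<le> a * j0"
        using mult_le_mono2 by blast+
      moreover have "b * (a * K) = a * b * K" by simp
      ultimately show ?thesis unfolding t_def by linarith
    next
      assume "z \<in> {..<i0} \<times> {j0..<j0 + b * K}"
      then have "fst z \<le> i0" "snd z \<le> j0 + b * K" by auto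
      then have "b * fst z \<le> b * i0" "a * snd z \<le> a * (j0 + b * K)"
        using mult_le_mono2 by blast+
      moreover have "a * (j0 + b * K) = a * j0 + a * b * K" by (simp add: distrib_left)
      ultimately show ?thesis unfolding t_def by linarith
    qed
    finally show ?thesis by (simp add: s_def)
  qed
  \<comment> \<open>Only coefficients at u = 0 count, because K[x,y]/(f) is K[v].\<close>
  obtain d where d: "\<exists>z\<in>I. d z \<noteq> 0" "\<forall>k<s. (\<Sum>z\<in>I. d z * bcoeff (T z) 0 k) = 0"
    using linear_dependence[OF finI sI, of "\<lambda>z. bcoeff (T z) 0"] by auto
  define C where "C = bcomb d I"
  have "C \<noteq> 0" using d(1) finI bcomb_nonzero unfolding C_def by blast
  have "resty (bsubst C G) = 0"
  proof (rule poly_eqI)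
    fix k
    have "coeff (resty (bsubst C G)) k = (\<Sum>z\<in>I. d z * bcoeff (T z) 0 k)"
      by (simp add: C_def coeff_resty bsubst_bcomb bcoeff_sum T_def mult.assoc bcoeff_cst_mult)
    also have "\<dots> = 0"
    proof (cases "k < s")
      case False
      then have "bcoeff (T z) 0 k = 0" if "z \<in> I" for z
        using deg[OF that] bcoeff_degree[of "T z" 0 k] by fastforce
      then show ?thesis by simp
    qed (use d(2) in blast)
    finally show "coeff (resty (bsubst C G)) k = coeff 0 k" by simp
  qed
  then obtain B where "bsubst C G = vx * B" using resty_kernel by blast
  then have C: "C = F $ 1 * bsubst B F"
    using bsubst_GF[of C] by (simp add: bsubst_hom)
  then have "bsubst B F \<noteq> 0" using \<open>C \<noteq> 0\<close> by auto
  then obtain i1 j1 where top1: "wtop b a (bsubst B F) i1 j1" using wtop_ex by blast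
  have "bcoeff C (i0 + i1) (j0 + j1) \<noteq> 0"
    using bcoeff_mult_wtop[OF b(2) top top1] top top1 C by (simp add: wtop_def)
  then have "(i0 + i1, j0 + j1) \<in> I"
    using bcoeff_bcomb[OF finI, of d] by (auto simp: C_def split: if_splits)
  \<comment> \<open>Every exponent in \<open>I\<close> has x-part below \<open>i0\<close> or y-part
    below \<open>j0\<close>.\<close>
  then show False by (auto simp: I_def)
qed

text \<open>Here z is the variable that survives the restriction and \<open>\<omega>\<close> its
  weight. Some nonzero multiple E = P B is a sum of d_i(f) z^i with i < n. Its terms restrict to
  degrees n deg d_i + i, which differ modulo n, so nothing cancels at the top and the weighted
  degree of E is \<open>\<omega>\<close> times the degree of its restriction. For P and B separately
  the weighted degree is at least that product, so additivity forces equality for both.\<close>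

lemma wd_eq_degree_restriction:
  assumes "restriction \<rho>" "0 < b"
    and wt: "\<And>t P. wle b a t P \<Longrightarrow> \<rho> P \<noteq> 0 \<Longrightarrow> \<omega> * degree (\<rho> P) \<le> t"
    and z: "\<rho> z = [:0, 1:]" "wle b a \<omega> z"
    and f: "degree (\<rho> (F $ 1)) = n" "wle b a (\<omega> * n) (F $ 1)"
    and P: "P \<noteq> 0" "degree (bsubst P G) < n"
  shows "\<rho> P \<noteq> 0" "\<omega> * degree (\<rho> P) = wd b a P"
proof -
  interpret restriction \<rho> by fact
  define \<psi> where "\<psi> = bsubst P G"
  define \<xi> where "\<xi> = bsubst z G"
  define s where "s = degree \<psi>"
  define m where "m = n * degree \<xi> + 1"
  \<comment> \<open>These are n + m elements of the free K[u]-module of polynomials of v-degree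
    below s + m, where s < n. Including multiples of \<open>\<psi>\<close> replaces division by
    \<open>\<psi>\<close>, whose leading coefficient may fail to be a unit of K[u].\<close>
  define R where "R i = (if i < n then \<xi> ^ i else \<psi> * vy ^ (i - n))" for i
  have "\<psi> \<noteq> 0" using P by (simp add: \<psi>_def)
  have deg: "degree (R i) < s + m" if "i < n + m" for i
  proof (cases "i < n")
    case True
    have "degree (\<xi> ^ i) \<le> degree \<xi> * i" by (rule degree_power_le)
    also have "\<dots> \<le> degree \<xi> * n" using True by simp
    finally show ?thesis using True by (simp add: R_def m_def algebra_simps)
  next
    case False
    have "degree (\<psi> * vy ^ (i - n)) \<le> s + degree (vy ^ (i - n) :: 'a bpoly)"
      unfolding s_def by (rule degree_mult_le)
    also have "\<dots> \<le> s + (i - n)" by (simp add: vy_power degree_monom_le)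
    finally show ?thesis using False that by (simp add: R_def)
  qed
  have "s + m < card {..<n + m}" using P by (simp add: s_def \<psi>_def)
  then obtain d where d: "\<exists>i\<in>{..<n + m}. d i \<noteq> 0"
      "\<forall>k<s + m. (\<Sum>i<n + m. d i * coeff (R i) k) = 0"
    using linear_dependence[of "{..<n + m}" "s + m" "\<lambda>i. coeff (R i)"] by auto
  define E0 where "E0 = (\<Sum>i<n. smult (d i) (\<xi> ^ i))"
  define Y where "Y = (\<Sum>i\<in>{n..<n + m}. smult (d i) (vy ^ (i - n)))"
  have "(\<Sum>i<n + m. smult (d i) (R i)) = 0"
  proof (rule poly_eqI)
    fix k
    have "coeff (\<Sum>i<n + m. smult (d i) (R i)) k = (\<Sum>i<n + m. d i * coeff (R i) k)"
      by (simp add: coeff_sum)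
    also have "\<dots> = 0"
    proof (cases "k < s + m")
      case False
      then have "coeff (R i) k = 0" if "i < n + m" for i
        using deg[OF that] by (intro coeff_eq_0) simp
      then show ?thesis by simp
    qed (use d(2) in blast)
    finally show "coeff (\<Sum>i<n + m. smult (d i) (R i)) k = coeff 0 k" by simp
  qed
  moreover have "(\<Sum>i<n + m. smult (d i) (R i)) = E0 + \<psi> * Y"
  proof -
    have "{..<n + m} = {..<n} \<union> {n..<n + m}" by auto
    then have "(\<Sum>i<n + m. smult (d i) (R i))
        = (\<Sum>i<n. smult (d i) (R i)) + (\<Sum>i\<in>{n..<n + m}. smult (d i) (R i))"
      by (simp add: sum.union_disjoint ivl_disj_int)
    then show ?thesis by (simp add: R_def E0_def Y_def sum_distrib_left)
  qed
  ultimately have E0: "E0 = \<psi> * - Y" by (simp add: eq_neg_iff_add_eq_0)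
  \<comment> \<open>The multiples of \<open>\<psi>\<close> by distinct powers of v are independent,
    so the relation must involve powers of \<open>\<xi>\<close>.\<close>
  have dn: "\<exists>i<n. d i \<noteq> 0"
  proof (rule ccontr)
    assume none: "\<not> ?thesis"
    then have "Y = 0" using E0 \<open>\<psi> \<noteq> 0\<close> by (simp add: E0_def)
    have "d i = 0" if "i \<in> {n..<n + m}" for i
    proof -
      have "coeff Y (i - n) = (\<Sum>l\<in>{n..<n + m}. if l = i then d i else 0)"
        unfolding Y_def coeff_sum using that by (intro sum.cong) (auto simp: vy_power)
      then show ?thesis using that \<open>Y = 0\<close> by simp
    qed
    then show False using d(1) none by (metis atLeastLessThan_iff lessThan_iff not_less)
  qed
  define E where "E = bsubst E0 F"
  define B where "B = bsubst (- Y) F"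
  have EPB: "E = P * B" by (simp add: E_def E0 B_def \<psi>_def bsubst_hom)
  define f0 where "f0 = \<rho> (F $ 1)"
  have n: "0 < n" using P by simp
  have Esum: "E = (\<Sum>i<n. isub (d i) (F $ 1) * z ^ i)"
    by (simp add: E_def E0_def bsubst_hom bsubst_smult \<xi>_def)
  define T where "T i = pcompose (d i) f0 * [:0, 1:] ^ i" for i
  define \<delta> where "\<delta> i = degree (d i) * n + i" for i
  have T0: "T i \<noteq> 0 \<longleftrightarrow> d i \<noteq> 0" for i
    using f(1) n by (auto simp: T_def f0_def dest: pcompose_eq_0)
  have degT: "degree (T i) = \<delta> i" if "d i \<noteq> 0" for i
  proof -
    have "pcompose (d i) f0 \<noteq> 0" using T0[of i] that by (auto simp: T_def)
    then show ?thesis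
      using f(1) by (simp add: T_def \<delta>_def degree_mult_eq degree_pcompose degree_power_eq f0_def)
  qed
  define S where "S = {i. i < n \<and> d i \<noteq> 0}"
  have "finite (\<delta> ` S)" "\<delta> ` S \<noteq> {}" using dn by (auto simp: S_def)
  then have "Max (\<delta> ` S) \<in> \<delta> ` S" "\<forall>i\<in>S. \<delta> i \<le> Max (\<delta> ` S)"
    using Max_in by auto
  then obtain i0 where i0: "i0 \<in> S" "\<forall>i\<in>S. \<delta> i \<le> \<delta> i0" by force
  have less: "\<delta> i < \<delta> i0" if "i \<in> S" "i \<noteq> i0" for i
  proof -
    have "\<delta> i mod n = i" "\<delta> i0 mod n = i0" using that i0 by (auto simp: \<delta>_def S_def)
    then show ?thesis using i0(2) that by (metis le_neq_implies_less)
  qed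
  have rhoE: "\<rho> E = (\<Sum>i<n. T i)"
    by (simp add: Esum rho_sum rho_mult rho_isub rho_power z T_def f0_def)
  have E_deg: "\<rho> E \<noteq> 0" "\<delta> i0 \<le> degree (\<rho> E)"
    using degree_sum_distinct[of "{..<n}" i0 T] i0 less T0 degT unfolding rhoE
    by (auto simp: S_def)
  have "wle b a (\<omega> * \<delta> i0) E"
    unfolding Esum
  proof (rule wle_sum)
    fix i assume "i \<in> {..<n}"
    show "wle b a (\<omega> * \<delta> i0) (isub (d i) (F $ 1) * z ^ i)"
    proof (cases "d i = 0")
      case False
      then have "\<delta> i \<le> \<delta> i0" using i0(2) \<open>i \<in> {..<n}\<close> by (simp add: S_def)
      then have "degree (d i) * (\<omega> * n) + i * \<omega> \<le> \<omega> * \<delta> i0"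
        using mult_le_mono2[of "\<delta> i" "\<delta> i0" \<omega>] by (simp add: \<delta>_def algebra_simps)
      then show ?thesis
        using wle_mult[OF wle_isub[OF f(2), of "d i"] wle_power[OF z(2), of i]] wle_mono by blast
    qed simp
  qed
  then have "wd b a E \<le> \<omega> * degree (\<rho> E)"
    using wd_le E_deg(2) mult_le_mono2 order_trans by meson
  moreover have nz: "\<rho> P \<noteq> 0" "\<rho> B \<noteq> 0" using E_deg(1) by (auto simp: EPB rho_mult)
  then have "P \<noteq> 0" "B \<noteq> 0" by auto
  then have "wd b a E = wd b a P + wd b a B" using assms(2) by (simp add: EPB wd_mult)
  moreover have "degree (\<rho> E) = degree (\<rho> P) + degree (\<rho> B)"
    using nz by (simp add: EPB rho_mult degree_mult_eq)
  moreover have "\<omega> * degree (\<rho> P) \<le> wd b a P" "\<omega> * degree (\<rho> B) \<le> wd b a B"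
    using wt wle_wd nz by blast+
  ultimately show "\<omega> * degree (\<rho> P) = wd b a P"
    by (simp add: algebra_simps)
  show "\<rho> P \<noteq> 0" by (rule nz)
qed

text \<open>The dimension count bounds the degree from below, the weight bound a b on f from above.
  Thus f contains x^a and, by the next lemma, y^b.\<close>

lemma degree_restx_F1:
  assumes "b = degree (G $ 1)" "0 < b" "a = degree (G $ 2)" "0 < a"
  shows "degree (restx (F $ 1)) = a"
proof (rule antisym)
  show ge: "a \<le> degree (restx (F $ 1))"
    using degree_restriction_ge[OF restriction_restx restx_kernel] assms by simp
  then have "restx (F $ 1) \<noteq> 0" using assms by auto
  then show "degree (restx (F $ 1)) \<le> a"
    using degree_restx[OF wle_F1[OF assms(1-3)]] assms(2) by (simp add: mult.commute)
qed

lemma degree_resty_F1: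
  assumes "b = degree (G $ 1)" "0 < b" "a = degree (G $ 2)" "0 < a"
  shows "degree (resty (F $ 1)) = b"
proof (rule antisym)
  show ge: "b \<le> degree (resty (F $ 1))"
    using degree_restriction_ge[OF restriction_resty resty_kernel] assms by simp
  then have "resty (F $ 1) \<noteq> 0" using assms by auto
  then show "degree (resty (F $ 1)) \<le> b"
    using degree_resty[OF wle_F1[OF assms(1-3)]] assms(4) by simp
qed

text \<open>If P(p,q) is nonzero of v-degree below min(a,b), both restrictions compute the weighted
  degree of P, so b deg(restx P) = a deg(resty P) and \<open>\<beta>\<close> divides deg(restx P).
  If neither of a, b divides the other, then gcd(a,b) < min(a,b). Then a nonzero combination of the
  f^i g^j with j < min(a,b) exists whose restriction has no coefficient at a multiple of
  \<open>\<beta>\<close>, and hence no possible degree.\<close>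

theorem degree_dvd_degree:
  assumes b: "b = degree (G $ 1)" "0 < b" and a: "a = degree (G $ 2)" "0 < a"
  shows "a dvd b \<or> b dvd a"
proof (rule ccontr)
  assume neg: "\<not> ?thesis"
  define g where "g = gcd a b"
  define m where "m = min a b"
  define \<beta> where "\<beta> = a div g"
  have g: "0 < g" "g dvd a" "g dvd b" using a by (auto simp: g_def)
  have "g \<noteq> a" "g \<noteq> b" using neg g by auto
  moreover have "g \<le> a" "g \<le> b" using g a b by (auto intro: dvd_imp_le)
  ultimately have gm: "Suc g \<le> m" by (simp add: m_def)
  have ag: "a = \<beta> * g" using g by (simp add: \<beta>_def)
  then have \<beta>: "0 < \<beta>" using a by (cases \<beta>) auto
  note f = wle_F1[OF b a(1)]
  have x: "restx P \<noteq> 0" "b * degree (restx P) = wd b a P"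
    if "P \<noteq> 0" "degree (bsubst P G) < m" for P
  proof -
    have "restx vx = [:0, 1:]" "degree (bsubst P G) < a" "wle b a (b * a) (F $ 1)"
      using that f by (simp_all add: restx_def vx_def m_def mult.commute)
    from wd_eq_degree_restriction[where \<omega> = b, OF restriction_restx b(2) _ this(1) wle_vx
        degree_restx_F1[OF b a] this(3) that(1) this(2)]
    show "restx P \<noteq> 0" "b * degree (restx P) = wd b a P"
      using degree_restx by blast+
  qed
  have y: "a * degree (resty P) = wd b a P"
    if "P \<noteq> 0" "degree (bsubst P G) < m" for P
  proof -
    have "resty vy = [:0, 1:]" "degree (bsubst P G) < b" "wle b a (a * b) (F $ 1)"
      using that f by (simp_all add: resty_def vy_def m_def map_poly_pCons)
    from wd_eq_degree_restriction(2)[where \<omega> = a, OF restriction_resty b(2) _ this(1) wle_vy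
        degree_resty_F1[OF b a] this(3) that(1) this(2)]
    show ?thesis using degree_resty by blast
  qed
  have dvd: "\<beta> dvd degree (restx P)" if "P \<noteq> 0" "degree (bsubst P G) < m" for P
  proof -
    have "a dvd b * degree (restx P)" using x(2)[OF that] y[OF that] by (metis dvd_triv_left)
    then show ?thesis using div_gcd_dvd_of_dvd_mult a(2) by (simp add: \<beta>_def g_def)
  qed
  define B where "B = degree (restx (F $ 2))"
  define L where "L = m * B + 2"
  \<comment> \<open>Every multiple \<open>\<beta> * k\<close> up to the degree bound a L + m B has k
    < s, because a = \<open>\<beta> * g\<close>; and g < m gives s < L m.\<close>
  define s where "s = g * L + m * B + 1"
  define I where "I = {..<L} \<times> {..<m}"
  define T where "T z = restx (F $ 1) ^ fst z * restx (F $ 2) ^ snd z" for z :: "nat \<times> nat"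
  interpret restriction restx by (rule restriction_restx)
  have deg: "degree (T z) \<le> a * L + m * B" if "z \<in> I" for z
  proof -
    have "degree (T z) \<le> a * fst z + B * snd z"
      unfolding T_def B_def using degree_power_mult_le degree_restx_F1[OF b a] by metis
    also have "a * fst z \<le> a * L" using that by (auto simp: I_def)
    also have "B * snd z \<le> m * B" using that by (auto simp: I_def)
    finally show ?thesis by simp
  qed
  have "s < L + g * L" by (simp add: s_def L_def)
  also have "\<dots> \<le> L * m" using mult_le_mono2[OF gm, of L] by (simp add: algebra_simps)
  also have "L * m = card I" by (simp add: I_def card_cartesian_product)
  finally have "s < card I" .
  moreover have finI: "finite I" by (simp add: I_def)
  ultimately obtain d where d: "\<exists>z\<in>I. d z \<noteq> 0"
      "\<forall>k<s. (\<Sum>z\<in>I. d z * coeff (T z) (\<beta> * k)) = 0"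
    using linear_dependence[of I s "\<lambda>z k. coeff (T z) (\<beta> * k)"] by auto
  define H where "H = bcomb d I"
  define P where "P = bsubst H F"
  have "H \<noteq> 0" using d(1) finI bcomb_nonzero unfolding H_def by blast
  then have "P \<noteq> 0" by (simp add: P_def)
  have "degree H < m"
    unfolding H_def using finI \<open>H \<noteq> 0\<close> by (intro degree_bcomb) (auto simp: I_def H_def)
  then have degP: "degree (bsubst P G) < m" by (simp add: P_def)
  have rP: "restx P = (\<Sum>z\<in>I. smult (d z) (T z))"
    by (simp add: P_def H_def rho_bcomb T_def)
  obtain k where k: "degree (restx P) = \<beta> * k" using dvd[OF \<open>P \<noteq> 0\<close> degP] by blast
  have "degree (restx P) \<le> a * L + m * B"
    unfolding rP using deg degree_smult_le order_trans finI
    by (intro degree_sum_le) blast+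
  also have "\<dots> \<le> \<beta> * (g * L + m * B)" using \<beta> by (simp add: ag algebra_simps)
  finally have "k < s" using \<beta> by (simp add: k s_def)
  then have "coeff (restx P) (degree (restx P)) = 0"
    unfolding k using d(2) by (simp add: rP coeff_sum)
  then show False using x(1)[OF \<open>P \<noteq> 0\<close> degP] by simp
qed

end

section \<open>Binary forms and the leading coefficients of p and q\<close>

definition homog :: "nat \<Rightarrow> 'a::field poly \<Rightarrow> 'a poly \<Rightarrow> 'a poly \<Rightarrow> 'a poly" where
  "homog n H P Q = (\<Sum>j\<le>n. smult (coeff H j) (P ^ (n - j) * Q ^ j))"

lemma homog_add: "homog n (H + H') P Q = homog n H P Q + homog n H' P Q"
  by (simp add: homog_def smult_add_left sum.distrib)

lemma homog_smult: "homog n (smult k H) P Q = smult k (homog n H P Q)"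
  by (simp add: homog_def poly_eq_iff coeff_sum sum_distrib_left mult.assoc)

lemma homog_pCons: "homog (Suc n) (pCons h S) P Q = smult h (P ^ Suc n) + Q * homog n S P Q"
  unfolding homog_def
  by (subst sum.atMost_Suc_shift) (simp add: sum_distrib_left mult.left_commute del: sum.atMost_Suc)

lemma homog_Suc: "degree S \<le> n \<Longrightarrow> homog (Suc n) S P Q = P * homog n S P Q"
  by (simp add: homog_def coeff_eq_0 sum_distrib_left Suc_diff_le algebra_simps)

text \<open>For nonzero P, \<open>homog n H P Q\<close> is P^n H(Q/P); replacing Q by
  \<open>\<kappa>\<close> P + R shifts the argument of H by \<open>\<kappa>\<close>.\<close>

lemma homog_shift:
  "degree H \<le> n \<Longrightarrow> homog n H P (smult \<kappa> P + R) = homog n (pcompose H [:\<kappa>, 1:]) P R"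
proof (induction n arbitrary: H)
  case 0
  then obtain h where "H = [:h:]" using degree0_coeffs by blast
  then show ?case by (simp add: homog_def)
next
  case (Suc n)
  obtain h S where H: "H = pCons h S" by (cases H)
  define S' where "S' = pcompose S [:\<kappa>, 1:]"
  have S: "degree S \<le> n" using Suc.prems H by (simp split: if_splits)
  then have S': "degree S' \<le> n" by (simp add: S'_def degree_pcompose)
  have "pcompose H [:\<kappa>, 1:] = smult \<kappa> S' + pCons h S'"
    by (simp add: H pcompose_pCons S'_def)
  then show ?case
    using Suc.IH[OF S] homog_Suc[OF S', of P R]
    by (simp add: H homog_pCons homog_add homog_smult S'_def algebra_simps)
qed

text \<open>The degree of the j-th term is affine in j with slope deg Q - deg P, so nonzero terms
  have distinct degrees and the largest survives.\<close>

lemma homog_nonzero: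
  assumes "degree P \<noteq> degree Q" "P \<noteq> 0" "Q \<noteq> 0" "H \<noteq> 0" "degree H \<le> n"
  shows "homog n H P Q \<noteq> 0"
proof -
  define T where "T j = smult (coeff H j) (P ^ (n - j) * Q ^ j)" for j
  define S where "S = {j. j \<le> n \<and> coeff H j \<noteq> 0}"
  define \<delta> where "\<delta> j = degree P * (n - j) + degree Q * j" for j
  have T: "T j \<noteq> 0" "degree (T j) = \<delta> j" if "j \<in> S" for j
    using that assms by (simp_all add: T_def S_def \<delta>_def degree_mult_eq degree_power_eq)
  have "inj_on \<delta> {..n}"
  proof (rule inj_onI)
    fix i j assume ij: "i \<in> {..n}" "j \<in> {..n}" "\<delta> i = \<delta> j"
    have "int (\<delta> l) = int (degree P) * int n + (int (degree Q) - int (degree P)) * int l" if "l \<le> n" for l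
      using that by (auto simp: \<delta>_def le_iff_add algebra_simps)
    then have "(int (degree Q) - int (degree P)) * int i = (int (degree Q) - int (degree P)) * int j"
      using ij by (metis add_left_cancel atMost_iff)
    then show "i = j" using assms(1) by simp
  qed
  have fin: "finite S" by (simp add: S_def)
  have "degree H \<in> S" using assms by (simp add: S_def)
  then have "finite (\<delta> ` S)" "\<delta> ` S \<noteq> {}" using fin by auto
  then have "Max (\<delta> ` S) \<in> \<delta> ` S" "\<forall>j\<in>S. \<delta> j \<le> Max (\<delta> ` S)"
    using Max_in by auto
  then obtain j0 where j0: "j0 \<in> S" "\<forall>j\<in>S. \<delta> j \<le> \<delta> j0" by force
  have "(\<Sum>j\<le>n. T j) \<noteq> 0"
  proof (rule degree_sum_distinct)
    show "j0 \<in> {..n}" "T j0 \<noteq> 0" using j0 T by (auto simp: S_def)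
    fix j assume j: "j \<in> {..n}" "j \<noteq> j0" "T j \<noteq> 0"
    then have "j \<in> S" by (auto simp: S_def T_def)
    moreover have "\<delta> j \<noteq> \<delta> j0"
      using \<open>inj_on \<delta> {..n}\<close> j j0(1) by (auto simp: inj_on_def S_def)
    ultimately show "degree (T j) < degree (T j0)" using j0 T by (simp add: le_neq_implies_less)
  qed simp
  then show ?thesis by (simp add: homog_def T_def)
qed

text \<open>This says that $K$ is algebraically closed in $K(u)$.\<close>

lemma homog_eq_0_imp_proportional:
  assumes "homog n H P Q = 0" "H \<noteq> 0" "degree H \<le> n" "P \<noteq> 0" "Q \<noteq> 0"
  obtains \<kappa> where "Q = smult \<kappa> P"
proof -
  \<comment> \<open>This makes the remainder \<open>R\<close> lose its coefficient at the degree of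
    P, so a nonzero \<open>R\<close> would contradict \<open>homog_nonzero\<close> for the shifted
    form.\<close>
  define \<kappa> where "\<kappa> = lead_coeff Q / lead_coeff P"
  define R where "R = Q - smult \<kappa> P"
  have deg: "degree P = degree Q" using homog_nonzero assms by blast
  have "R = 0"
  proof (rule ccontr)
    assume R: "R \<noteq> 0"
    have "coeff R (degree P) = 0" using assms(4) by (simp add: R_def \<kappa>_def flip: deg)
    then have "degree R \<noteq> degree P" using R by (metis leading_coeff_0_iff)
    moreover have "homog n (pcompose H [:\<kappa>, 1:]) P R = 0"
      using homog_shift[OF assms(3), of P \<kappa> R] assms(1) by (simp add: R_def)
    moreover have "pcompose H [:\<kappa>, 1:] \<noteq> 0" using assms(2) by (auto dest: pcompose_eq_0)
    moreover have "degree (pcompose H [:\<kappa>, 1:]) \<le> n" using assms(3) by (simp add: degree_pcompose)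
    ultimately show False using homog_nonzero assms(4) R by metis
  qed
  then have "Q = smult \<kappa> P" by (simp add: R_def)
  then show thesis by (rule that)
qed

lemma coeff_power_mult_top:
  fixes A B :: "'r::idom poly"
  assumes "A \<noteq> 0" "B \<noteq> 0" "degree A * i + degree B * j \<le> t"
  shows "coeff (A ^ i * B ^ j) t
    = (if degree A * i + degree B * j = t then lead_coeff A ^ i * lead_coeff B ^ j else 0)"
proof -
  have "degree (A ^ i * B ^ j) = degree A * i + degree B * j"
    using assms by (simp add: degree_mult_eq degree_power_eq mult.commute)
  then show ?thesis
    using assms(3) lead_coeff_mult[of "A ^ i" "B ^ j"]
    by (auto simp: coeff_eq_0 lead_coeff_power)
qed

context inverse_pair
begin

text \<open>In the coefficient of v^(a b) of f(p,q) = u only monomials of top weight in f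
  contribute. This is a homogeneous relation over K between P^k and Q, where P and Q in K[u] are the
  leading coefficients of p and q. Hence Q is a constant multiple of P^k, and the leading terms of q
  and \<open>\<kappa>\<close> p^k cancel.\<close>

lemma degree_reduction:
  assumes b: "b = degree (G $ 1)" "0 < b" and a: "a = degree (G $ 2)" "0 < a"
    and k: "a = b * k"
  obtains \<kappa> where "degree (G $ 2 - cst \<kappa> * (G $ 1) ^ k) < a"
proof -
  define P where "P = lead_coeff (G $ 1)"
  define Q where "Q = lead_coeff (G $ 2)"
  have nz: "G $ 1 \<noteq> 0" "G $ 2 \<noteq> 0" using a b by auto
  then have PQ: "P \<noteq> 0" "Q \<noteq> 0" by (simp_all add: P_def Q_def)
  define I where "I = {..a} \<times> {..b}"
  define c where "c i j = bcoeff (F $ 1) i j" for i j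
  have w: "b * i + a * j \<le> a * b" if "c i j \<noteq> 0" for i j
    using wle_F1[OF b a(1)] that by (auto simp: wle_def c_def)
  have finI: "finite I" by (simp add: I_def)
  have supp: "(i, j) \<in> I" if "c i j \<noteq> 0" for i j
  proof -
    have "b * i \<le> a * b" "a * j \<le> a * b" using w[OF that] by linarith+
    then have "i \<le> a" "j \<le> b" using a(2) b(2) by (simp_all add: mult.commute[of a b])
    then show ?thesis by (simp add: I_def)
  qed
  have exp: "F $ 1 = bcomb (\<lambda>z. c (fst z) (snd z)) I"
    unfolding c_def using finI supp c_def by (intro bcomb_bcoeff[symmetric]) auto
  have "vx = (\<Sum>z\<in>I. cst (c (fst z) (snd z)) * ((G $ 1) ^ fst z * (G $ 2) ^ snd z))"
    using bsubst_F1 bsubst_bcomb[of "\<lambda>z. c (fst z) (snd z)" I G] exp by (simp add: mult.assoc)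
  then have "coeff vx (a * b) = coeff (\<Sum>z\<in>I. cst (c (fst z) (snd z))
      * ((G $ 1) ^ fst z * (G $ 2) ^ snd z)) (a * b)"
    by (rule arg_cong)
  also have "\<dots> = (\<Sum>z\<in>I. smult (c (fst z) (snd z))
      (coeff ((G $ 1) ^ fst z * (G $ 2) ^ snd z) (a * b)))"
    by (simp add: coeff_sum cst_def)
  also have "\<dots> = (\<Sum>z\<in>I. if b * fst z + a * snd z = a * b
      then smult (c (fst z) (snd z)) (P ^ fst z * Q ^ snd z) else 0)"
  proof (rule sum.cong[OF refl])
    fix z assume "z \<in> I"
    show "smult (c (fst z) (snd z)) (coeff ((G $ 1) ^ fst z * (G $ 2) ^ snd z) (a * b))
      = (if b * fst z + a * snd z = a * b
         then smult (c (fst z) (snd z)) (P ^ fst z * Q ^ snd z) else 0)"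
      using w[of "fst z" "snd z"] coeff_power_mult_top[OF nz, of "fst z" "snd z" "a * b"]
      by (cases "c (fst z) (snd z) = 0") (auto simp: P_def Q_def b a)
  qed
  \<comment> \<open>As a = b k, the exponents of weight a b are the pairs (k (b - j), j) with j at
    most b.\<close>
  also have "\<dots> = (\<Sum>z\<in>(\<lambda>j. (k * (b - j), j)) ` {..b}. smult (c (fst z) (snd z)) (P ^ fst z * Q ^ snd z))"
  proof (rule sum.mono_neutral_cong_right[OF finI])
    show "(\<lambda>j. (k * (b - j), j)) ` {..b} \<subseteq> I"
      using k mult_le_mono2[of _ b k] by (auto simp: I_def mult.commute)
    have iff: "b * i + a * j = a * b \<longleftrightarrow> i = k * (b - j)" if "j \<le> b" for i j
    proof -
      obtain l where l: "b = j + l" using \<open>j \<le> b\<close> le_Suc_ex by blast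
      have "a * b = b * (k * l) + a * j" using k l by (simp add: algebra_simps)
      then have "b * i + a * j = a * b \<longleftrightarrow> b * i = b * (k * l)" by linarith
      also have "\<dots> \<longleftrightarrow> i = k * l" using b(2) by simp
      also have "l = b - j" using l by simp
      finally show ?thesis .
    qed
    show "\<forall>z\<in>I - (\<lambda>j. (k * (b - j), j)) ` {..b}. (if b * fst z + a * snd z = a * b
         then smult (c (fst z) (snd z)) (P ^ fst z * Q ^ snd z) else 0) = 0"
    proof
      fix z assume z: "z \<in> I - (\<lambda>j. (k * (b - j), j)) ` {..b}"
      then have "b * fst z + a * snd z \<noteq> a * b"
        using iff[of "snd z" "fst z"] by (cases z) (auto simp: I_def)
      then show "(if b * fst z + a * snd z = a * b
         then smult (c (fst z) (snd z)) (P ^ fst z * Q ^ snd z) else 0) = 0" by simp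
    qed
    show "(if b * fst z + a * snd z = a * b
         then smult (c (fst z) (snd z)) (P ^ fst z * Q ^ snd z) else 0)
       = smult (c (fst z) (snd z)) (P ^ fst z * Q ^ snd z)"
      if "z \<in> (\<lambda>j. (k * (b - j), j)) ` {..b}" for z
      using that iff by auto
  qed
  also have "\<dots> = (\<Sum>j\<le>b. smult (c (k * (b - j)) j) ((P ^ k) ^ (b - j) * Q ^ j))"
    by (subst sum.reindex) (auto simp: inj_on_def power_mult)
  \<comment> \<open>The left side vanishes because a b > 0 while u has degree 0 in v.\<close>
  finally have rel: "(\<Sum>j\<le>b. smult (c (k * (b - j)) j) ((P ^ k) ^ (b - j) * Q ^ j)) = 0"
    using a b by (simp add: vx_def coeff_eq_0)
  define H where "H = (\<Sum>j\<le>b. monom (c (k * (b - j)) j) j)"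
  have cH: "coeff H j = (if j \<le> b then c (k * (b - j)) j else 0)" for j
    by (simp add: H_def coeff_sum)
  have "homog b H (P ^ k) Q = 0"
    using rel by (simp add: homog_def cH)
  \<comment> \<open>This is the coefficient of y^b in f, the leading one of its restriction to x =
    0.\<close>
  moreover have "coeff H b \<noteq> 0"
    using degree_resty_F1[OF b a] b(2) coeff_resty[of "F $ 1" b]
    by (simp add: cH c_def) (metis degree_0 leading_coeff_0_iff less_numeral_extra(3))
  moreover from this have "H \<noteq> 0" by auto
  moreover have "degree H \<le> b" by (rule degree_le) (simp add: cH)
  moreover have "P ^ k \<noteq> 0" using PQ by simp
  ultimately obtain \<kappa> where \<kappa>: "Q = smult \<kappa> (P ^ k)"
    using homog_eq_0_imp_proportional PQ(2) by metis
  have "\<kappa> \<noteq> 0" using \<kappa> PQ by auto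
  have deg: "degree (cst \<kappa> * (G $ 1) ^ k) = a"
    using nz \<open>\<kappa> \<noteq> 0\<close> k b by (simp add: cst_def degree_power_eq mult.commute)
  have "coeff (cst \<kappa> * (G $ 1) ^ k) a = Q"
    using \<kappa> nz k b by (simp add: cst_def P_def lead_coeff_power degree_power_eq mult.commute
        flip: lead_coeff_power)
  then have "coeff (G $ 2 - cst \<kappa> * (G $ 1) ^ k) a = 0" by (simp add: Q_def a)
  moreover have "degree (G $ 2 - cst \<kappa> * (G $ 1) ^ k) \<le> a"
    using degree_diff_le[of "G $ 2" a "cst \<kappa> * (G $ 1) ^ k"] deg a by simp
  ultimately have "degree (G $ 2 - cst \<kappa> * (G $ 1) ^ k) < a"
    using a(2) by (metis degree_0 le_neq_implies_less leading_coeff_0_iff)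
  then show thesis by (rule that)
qed

end

subsection \<open>Reduction by elementary maps\<close>

definition elem_x :: "'a::field poly \<Rightarrow> 'a polymap" where "elem_x r = pm (vx + isub r vy) vy"
definition elem_y :: "'a::field poly \<Rightarrow> 'a polymap" where "elem_y r = pm vx (vy + isub r vx)"
definition elementary_maps :: "'a::field polymap set" where
  "elementary_maps = range elem_x \<union> range elem_y"

lemma isub_uminus: "isub (- r) X = - isub r X"
  using isub_smult[of "-1" r X] by simp

lemma elem_x_comp: "pm_comp (elem_x r) F = pm (F $ 1 + isub r (F $ 2)) (F $ 2)"
  and elem_y_comp: "pm_comp (elem_y r) F = pm (F $ 1) (F $ 2 + isub r (F $ 1))"
  by (rule polymap_eqI; simp add: elem_x_def elem_y_def bsubst_add bsubst_isub_comp)+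

lemma elem_nth [simp]:
  "elem_x r $ 1 = vx + isub r vy" "elem_x r $ 2 = vy"
  "elem_y r $ 1 = vx" "elem_y r $ 2 = vy + isub r vx"
  by (simp_all add: elem_x_def elem_y_def)

lemma elem_inverse:
  "inverse_pair (elem_x r) (elem_x (- r))" "inverse_pair (elem_y r) (elem_y (- r))"
  by (standard; simp add: elem_x_comp elem_y_comp isub_uminus pm_id_eq)+

lemma pm_invertible_iff: "pm_invertible F \<longleftrightarrow> (\<exists>G. inverse_pair F G)"
  by (simp add: pm_invertible_def inverse_pair_def)

text \<open>The first difference sends the moved variable to a polynomial in the fixed one, which
  the second difference kills.\<close>

lemma elementary_maps_subset_PF: "elementary_maps \<subseteq> PF"
proof -
  have "pascal_finite (elem_x r)" "pascal_finite (elem_y r)" for r :: "'a poly"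
    unfolding pascal_finite_def
    by (rule exI[of _ 2],
        simp add: forall_2 numeral_2_eq_2 pm_Delta_def bsubst_isub_comp bsubst_hom)+
  moreover have "pm_invertible (elem_x r)" "pm_invertible (elem_y r)" for r :: "'a poly"
    unfolding pm_invertible_iff using elem_inverse by blast+
  ultimately show ?thesis by (auto simp: elementary_maps_def PF_def)
qed

lemma comp_closure_mono: "F \<in> comp_closure S \<Longrightarrow> S \<subseteq> T \<Longrightarrow> F \<in> comp_closure T"
  by (induction rule: comp_closure.induct) (auto intro: comp_closure.intros)

lemma comp_closure_comp:
  "F \<in> comp_closure S \<Longrightarrow> G \<in> comp_closure S \<Longrightarrow> pm_comp F G \<in> comp_closure S"
  by (induction rule: comp_closure.induct) (auto intro: comp_closure.intros simp: pm_comp_assoc)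

definition diag_x :: "'a::field \<Rightarrow> 'a polymap" where "diag_x \<delta> = pm (cst \<delta> * vx) vy"

text \<open>\<open>diag_x \<delta>\<close> accounts for the Jacobian determinant, which elementary
  maps leave unchanged. It is applied first; \<open>diag_x_elem\<close> moves it past elementary
  maps composed on its right.\<close>

definition tame :: "'a::field polymap \<Rightarrow> bool" where
  "tame F \<longleftrightarrow> (\<exists>\<delta> H. \<delta> \<noteq> 0 \<and> H \<in> comp_closure elementary_maps \<and> F = pm_comp H (diag_x \<delta>))"

lemma isub_pcompose: "isub (pcompose r s) X = isub r (isub s X)"
  by (induction r) (auto simp: pcompose_pCons isub_add isub_mult)

lemma cst_inverse [simp]:
  assumes "k \<noteq> 0"
  shows "cst k * cst (1 / k) = 1" "cst k * (cst (1 / k) * P) = P"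
    "cst (1 / k) * cst k = 1" "cst (1 / k) * (cst k * P) = P"
proof -
  show 1: "cst k * cst (1 / k) = 1" "cst (1 / k) * cst k = 1"
    using assms by (simp_all add: cst_def one_pCons)
  show "cst k * (cst (1 / k) * P) = P" "cst (1 / k) * (cst k * P) = P"
    using 1 by (simp_all flip: mult.assoc)
qed

lemma isub_scale:
  assumes "k \<noteq> 0"
  shows "isub (pcompose r [:0, 1 / k:]) (cst k * X) = isub r X"
proof -
  have "isub [:0, 1 / k:] (cst k * X) = cst k * (cst (1 / k) * X)"
    by (simp only: isub_pCons isub_0 cst_simps mult_zero_right mult_zero_left add_0_left add_0_right mult_ac)
  also have "\<dots> = X" using assms by simp
  finally show ?thesis by (simp only: isub_pcompose)
qed

text \<open>Diagonal maps normalise the elementary ones: conjugation only rescales r or its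
  argument.\<close>

lemma diag_x_elem:
  assumes "\<delta> \<noteq> 0" "E \<in> elementary_maps"
  obtains E' where "E' \<in> elementary_maps" "pm_comp (diag_x \<delta>) E = pm_comp E' (diag_x \<delta>)"
proof -
  consider r where "E = elem_x r" | r where "E = elem_y r"
    using assms(2) by (auto simp: elementary_maps_def)
  then show thesis
  proof cases
    case 1
    have "pm_comp (diag_x \<delta>) E = pm_comp (elem_x (smult \<delta> r)) (diag_x \<delta>)"
      by (rule polymap_eqI)
        (simp_all add: 1 elem_x_comp diag_x_def bsubst_hom isub_smult algebra_simps)
    then show thesis using that by (auto simp: elementary_maps_def)
  next
    case 2
    have "pm_comp (diag_x \<delta>) E = pm_comp (elem_y (pcompose r [:0, 1 / \<delta>:])) (diag_x \<delta>)"
      by (rule polymap_eqI)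
        (simp_all add: 2 elem_y_comp diag_x_def bsubst_hom isub_scale assms(1))
    then show thesis using that by (auto simp: elementary_maps_def)
  qed
qed

lemma tame_comp_elem:
  assumes "tame F" "E \<in> elementary_maps"
  shows "tame (pm_comp F E)"
proof -
  obtain \<delta> H where F: "\<delta> \<noteq> 0" "H \<in> comp_closure elementary_maps" "F = pm_comp H (diag_x \<delta>)"
    using assms(1) by (auto simp: tame_def)
  obtain E' where E': "E' \<in> elementary_maps" "pm_comp (diag_x \<delta>) E = pm_comp E' (diag_x \<delta>)"
    using diag_x_elem F(1) assms(2) by blast
  have "pm_comp F E = pm_comp (pm_comp H E') (diag_x \<delta>)"
    using E'(2) by (simp add: F(3) pm_comp_assoc)
  moreover have "pm_comp H E' \<in> comp_closure elementary_maps"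
    by (rule comp_closure_comp[OF F(2) comp_closure.base[OF E'(1)]])
  ultimately show ?thesis using F(1) by (auto simp: tame_def)
qed

lemma tame_comp:
  "S \<in> comp_closure elementary_maps \<Longrightarrow> tame F \<Longrightarrow> tame (pm_comp F S)"
proof (induction arbitrary: F rule: comp_closure.induct)
  case (step E S)
  then show ?case using tame_comp_elem pm_comp_assoc by metis
qed (rule tame_comp_elem)

lemma inverse_pair_comp:
  assumes "inverse_pair F G" "inverse_pair S S'"
  shows "inverse_pair (pm_comp F S') (pm_comp S G)"
proof -
  interpret A: inverse_pair F G by fact
  interpret B: inverse_pair S S' by fact
  show ?thesis
    by standard (metis pm_comp_assoc pm_comp_id A.FG A.GF B.FG B.GF)+
qed

lemma tame_transfer:
  assumes "inverse_pair S S'" "S \<in> comp_closure elementary_maps" "tame (pm_comp F S')"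
  shows "tame F"
proof -
  interpret inverse_pair S S' by fact
  show ?thesis using tame_comp[OF assms(2,3)] by (simp add: pm_comp_assoc GF)
qed

text \<open>Sign and scalars give this exchange of the coordinates determinant 1 for nonzero t, as a
  product of elementary maps requires.\<close>

definition swap :: "'a::field \<Rightarrow> 'a polymap" where
  "swap t = pm (cst t * vy) (- (cst (1 / t) * vx))"

text \<open>The usual factorisation of such a matrix into three shears.\<close>

lemma swap_closure:
  assumes "t \<noteq> 0"
  shows "swap t \<in> comp_closure elementary_maps"
proof -
  have "swap t = pm_comp (elem_x [:0, t:]) (pm_comp (elem_y [:0, - 1 / t:]) (elem_x [:0, t:]))"
    using assms by (intro polymap_eqI) (simp_all add: elem_x_comp elem_y_comp swap_def algebra_simps)
  also have "\<dots> \<in> comp_closure elementary_maps"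
    by (intro comp_closure.intros) (auto simp: elementary_maps_def)
  finally show ?thesis .
qed

lemma swap_inverse: "inverse_pair (swap 1) (swap (- 1))"
  by standard (rule polymap_eqI; simp add: swap_def pm_id_eq bsubst_hom)+

lemma triangular_tame:
  assumes "e \<noteq> 0" "s \<noteq> 0"
  shows "tame (pm (cst e * vx + cst e0) (cst s * vy + isub r vx))"
proof -
  define H where "H = pm_comp (elem_x [:e0:]) (pm_comp (elem_y (pcompose r [:0, 1 / e:]))
    (pm_comp (swap 1) (swap (- s))))"
  \<comment> \<open>\<open>swap 1\<close> after \<open>swap (- s)\<close> is diag(1/s, s); combined
    with diag(e s, 1) this is diag(e, s).\<close>
  have W: "pm_comp (pm_comp (swap 1) (swap (- s))) (diag_x (e * s)) = pm (cst e * vx) (cst s * vy)"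
    using assms by (intro polymap_eqI) (simp_all add: swap_def diag_x_def bsubst_hom algebra_simps)
  have "pm_comp H (diag_x (e * s)) = pm (cst e * vx + cst e0) (cst s * vy + isub r vx)"
    unfolding H_def pm_comp_assoc W[unfolded pm_comp_assoc]
    by (simp add: elem_x_comp elem_y_comp isub_scale assms)
  moreover have "H \<in> comp_closure elementary_maps"
    unfolding H_def using assms
    by (intro comp_closure.step comp_closure_comp swap_closure) (auto simp: elementary_maps_def)
  ultimately show ?thesis using assms unfolding tame_def by (metis no_zero_divisors)
qed

lemma isub_outer: "isub r [:c:] = [:pcompose r c:]"
  by (induction r) (auto simp: pcompose_pCons cst_def)

lemma isub_degree: "degree (isub r X) = degree r * degree X"
proof -
  have "isub r X = pcompose (map_poly (\<lambda>k. [:k:]) r) X"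
    by (induction r) (auto simp: map_poly_pCons pcompose_pCons cst_def)
  moreover have "degree (map_poly (\<lambda>k. [:k:]) r) = degree r"
    by (rule degree_map_poly) auto
  ultimately show ?thesis by (simp add: degree_pcompose)
qed

text \<open>Base case of the induction: when p depends on u alone, comparing degrees forces F to be
  triangular.\<close>

lemma (in inverse_pair) tame_of_degree_0:
  assumes "degree (G $ 1) = 0"
  shows "tame F"
proof -
  obtain c where c: "G $ 1 = [:c:]" using assms degree0_coeffs by blast
  have X: "isub c (F $ 1) = vx"
    using bsubst_GF[of vx] by (simp add: c bsubst_inner)
  then have "degree c * degree (F $ 1) = 0" by (metis isub_degree isub_vx degree_pCons_0 vx_def)
  moreover have "degree c \<noteq> 0"
  proof
    assume "degree c = 0"
    then obtain k where "c = [:k:]" using degree0_coeffs by blast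
    then have "cst k = vx" using X by simp
    then show False by (simp add: cst_def vx_def)
  qed
  ultimately have "degree (F $ 1) = 0" by simp
  then obtain e where e: "F $ 1 = [:e:]" using degree0_coeffs by blast
  have "pcompose c e = [:0, 1:]" using X by (simp add: e isub_outer vx_def)
  then have "degree c * degree e = 1" by (metis degree_pcompose degree_pCons_eq_if degree_pCons_0 one_neq_zero One_nat_def pCons_eq_0_iff)
  then have dc: "degree c = 1" and de: "degree e = 1" by auto
  \<comment> \<open>Substituting p = c(u) for x in g turns g(p,q) = v into M(q) = v with
    coefficients in K[u].\<close>
  define M where "M = map_poly (\<lambda>r. pcompose r c) (F $ 2)"
  have pc0: "pcompose r c = 0 \<longleftrightarrow> r = 0" for r
    using dc pcompose_eq_0[of r c] by auto
  have "bsubst P G = pcompose (map_poly (\<lambda>r. pcompose r c) P) (G $ 2)" for P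
    by (induction P) (auto simp: bsubst_pCons map_poly_pCons pcompose_pCons c isub_outer)
  then have M: "pcompose M (G $ 2) = vy" using bsubst_F2 by (simp add: M_def)
  have dM: "degree M = degree (F $ 2)"
    unfolding M_def by (rule degree_map_poly) (simp add: pc0)
  have "degree M * degree (G $ 2) = 1"
    using M by (metis degree_pcompose degree_pCons_eq_if degree_pCons_0 one_neq_zero One_nat_def pCons_eq_0_iff vy_def)
  then have dF2: "degree (F $ 2) = 1" and dG2: "degree (G $ 2) = 1" using dM by auto
  obtain r s where rs: "F $ 2 = [:r, s:]" "s \<noteq> 0" using dF2 by (metis degree1_coeffs)
  obtain q0 q1 where q: "G $ 2 = [:q0, q1:]" "q1 \<noteq> 0" using dG2 by (metis degree1_coeffs)
  \<comment> \<open>Comparing coefficients of v makes s(c) a unit of K[u], so s is constant.\<close>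
  have "q1 * pcompose s c = 1"
    using M rs q by (simp add: M_def map_poly_pCons pcompose_pCons vy_def mult.commute)
  then have "degree (pcompose s c) = 0"
    by (metis degree_1 degree_mult_eq_0 mult_zero_left mult_zero_right zero_neq_one)
  then have "degree s = 0" using dc by (simp add: degree_pcompose)
  then obtain s0 where s0: "s = [:s0:]" using degree0_coeffs by blast
  obtain e0 e1 where e1: "e = [:e0, e1:]" "e1 \<noteq> 0" using de by (metis degree1_coeffs)
  have F: "F = pm (cst e1 * vx + cst e0) (cst s0 * vy + isub r vx)"
    by (rule polymap_eqI) (simp_all add: e e1 rs s0 cst_def vx_def vy_def isub_outer)
  show ?thesis unfolding F using e1 s0 rs by (intro triangular_tame) auto
qed

text \<open>Composing G on the left with an elementary map cancels the leading term of q, and F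
  absorbs the inverse map on the right. The induction hypothesis is a premise so that the lemma also
  serves the swapped pair.\<close>

lemma tame_reduce:
  fixes F G :: "'a::field polymap"
  assumes IH: "\<And>F' G' :: 'a polymap. inverse_pair F' G' \<Longrightarrow>
      degree (G' $ 1) + degree (G' $ 2) < degree (G $ 1) + degree (G $ 2) \<Longrightarrow> tame F'"
    and pair: "inverse_pair F G" and pos: "0 < degree (G $ 1)" "0 < degree (G $ 2)"
    and dvd: "degree (G $ 1) dvd degree (G $ 2)"
  shows "tame F"
proof -
  interpret inverse_pair F G by fact
  obtain k where k: "degree (G $ 2) = degree (G $ 1) * k" using dvd by blast
  obtain \<kappa> where \<kappa>: "degree (G $ 2 - cst \<kappa> * (G $ 1) ^ k) < degree (G $ 2)"
    using degree_reduction[OF refl pos(1) refl pos(2) k] by blast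
  define r where "r = monom (- \<kappa>) k"
  have "isub (monom 1 k) X = X ^ k" for X :: "'a bpoly"
    by (induction k) (auto simp: monom_Suc monom_0)
  then have "isub r X = - (cst \<kappa> * X ^ k)" for X
    using isub_smult[of "- \<kappa>" "monom 1 k" X] by (simp add: r_def smult_monom)
  then have "pm_comp (elem_y r) G = pm (G $ 1) (G $ 2 - cst \<kappa> * (G $ 1) ^ k)"
    by (simp add: elem_y_comp)
  then have "tame (pm_comp F (elem_y (- r)))"
    using IH[OF inverse_pair_comp[OF pair elem_inverse(2)[of r]]] \<kappa> by simp
  moreover have "elem_y r \<in> comp_closure elementary_maps"
    by (rule comp_closure.base) (simp add: elementary_maps_def)
  ultimately show ?thesis using tame_transfer[OF elem_inverse(2)] by blast
qed

text \<open>Induction on the sum of the degrees of p and q in v. Swapping exchanges p and q up to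
  sign, so it is enough to treat p of degree 0 and deg p dividing deg q; by
  \<open>degree_dvd_degree\<close> these cases and their mirror images are exhaustive.\<close>

theorem automorphism_tame:
  fixes F G :: "'a::field polymap"
  assumes "inverse_pair F G"
  shows "tame F"
  using assms
proof (induction "degree (G $ 1) + degree (G $ 2)" arbitrary: F G rule: less_induct)
  case less
  interpret inverse_pair F G by fact
  define F' where "F' = pm_comp F (swap (- 1))"
  define G' where "G' = pm_comp (swap 1) G"
  have G': "G' $ 1 = G $ 2" "G' $ 2 = - (G $ 1)"
    by (simp_all add: G'_def swap_def bsubst_hom)
  have F'G': "inverse_pair F' G'"
    unfolding F'_def G'_def using less.prems swap_inverse by (rule inverse_pair_comp)
  have swapF: "tame F" if "tame F'"
    using tame_transfer[OF swap_inverse swap_closure] that by (simp add: F'_def)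
  consider "degree (G $ 1) = 0" | "degree (G $ 2) = 0"
    | "0 < degree (G $ 1)" "0 < degree (G $ 2)" by blast
  then show ?case
  proof cases
    case 1
    then show ?thesis by (rule tame_of_degree_0)
  next
    case 2
    then show ?thesis using inverse_pair.tame_of_degree_0[OF F'G'] G' swapF by simp
  next
    case 3
    then consider "degree (G $ 1) dvd degree (G $ 2)" | "degree (G $ 2) dvd degree (G $ 1)"
      using degree_dvd_degree by blast
    then show ?thesis
    proof cases
      case 1
      show ?thesis by (rule tame_reduce[OF _ less.prems]) (use less.hyps 3 1 in blast)+
    next
      case 2
      have "degree (G' $ 1) + degree (G' $ 2) = degree (G $ 1) + degree (G $ 2)"
        by (simp add: G')
      note deg = this
      have "tame F'"
      proof (rule tame_reduce[OF _ F'G'])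
        show "tame F2" if "inverse_pair F2 G2"
            "degree (G2 $ 1) + degree (G2 $ 2) < degree (G' $ 1) + degree (G' $ 2)"
          for F2 G2 :: "'a polymap"
          using less.hyps[of G2 F2] that unfolding deg by blast
      qed (use 2 3 G' in simp_all)
      then show ?thesis by (rule swapF)
    qed
  qed
qed

subsection \<open>The Jacobian determinant\<close>

abbreviation dx :: "'a::field bpoly \<Rightarrow> 'a bpoly" where "dx \<equiv> map_poly pderiv"

lemma dx_simps: "dx (P + Q) = dx P + dx Q" "dx (cst k) = 0" "dx vx = 1" "dx vy = 0"
  "pderiv (cst k) = 0" "pderiv vx = 0" "pderiv vy = 1"
  by (simp add: poly_eq_iff coeff_map_poly pderiv_add)
    (simp_all add: cst_def vx_def vy_def pderiv_pCons map_poly_pCons one_pCons)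

lemma dx_mult: "dx (P * Q) = dx P * Q + P * dx Q"
proof (induction P rule: bpoly_induct)
  case (cst k)
  then show ?case
    by (simp add: dx_simps) (simp add: cst_def poly_eq_iff coeff_map_poly pderiv_smult)
next
  case (add A B)
  then show ?case by (simp add: dx_simps algebra_simps)
next
  case (x A)
  have "dx (vx * B) = B + vx * dx B" for B :: "'a bpoly"
    by (simp add: vx_def poly_eq_iff coeff_map_poly pderiv_mult pderiv_pCons flip: smult_add_right)
  note dxv = this
  have "dx (vx * A * Q) = A * Q + vx * dx (A * Q)"
    unfolding mult.assoc by (rule dxv)
  then show ?case unfolding dxv x by (simp add: algebra_simps)
next
  case (y A)
  have "dx (vy * B) = vy * dx B" for B :: "'a bpoly"
    by (simp add: vy_def map_poly_pCons)
  note dxv = this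
  have "dx (vy * A * Q) = vy * dx (A * Q)"
    unfolding mult.assoc by (rule dxv)
  then show ?case unfolding dxv y by (simp add: algebra_simps)
qed

lemma dx_isub: "dx (isub r A) = isub (pderiv r) A * dx A"
  and dy_isub: "pderiv (isub r A) = isub (pderiv r) A * pderiv A"
  by (induction r; simp add: dx_simps dx_mult pderiv_add pderiv_mult pderiv_pCons isub_add;
      simp add: algebra_simps)+

definition jac :: "'a::field polymap \<Rightarrow> 'a bpoly" where
  "jac F = dx (F $ 1) * pderiv (F $ 2) - pderiv (F $ 1) * dx (F $ 2)"

text \<open>By the chain rule, an elementary map on the left adds a multiple of one row of the
  Jacobian matrix to the other.\<close>

lemma jac_elem:
  assumes "E \<in> elementary_maps"
  shows "jac (pm_comp E F) = jac F"
proof -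
  have "jac (pm_comp (elem_x r) F) = jac F" "jac (pm_comp (elem_y r) F) = jac F" for r
    unfolding jac_def elem_x_comp elem_y_comp
    by (simp_all add: dx_simps pderiv_add dx_isub dy_isub algebra_simps)
  then show ?thesis using assms by (auto simp: elementary_maps_def)
qed

lemma jac_comp: "H \<in> comp_closure elementary_maps \<Longrightarrow> jac (pm_comp H F) = jac F"
  by (induction rule: comp_closure.induct) (simp_all add: jac_elem pm_comp_assoc)

lemma beval_0: "beval P 0 = bcoeff P 0 0"
  by (simp add: beval_def bcoeff_def poly_0_coeff_0)

text \<open>Tameness makes the Jacobian determinant of F the constant \<open>\<delta>\<close>; its
  value at the origin is 1, so the diagonal factor is the identity and only elementary maps
  remain.\<close>

lemma Aut_su_closure:
  assumes "F \<in> Aut_su"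
  shows "F \<in> comp_closure PF"
proof -
  obtain G where "inverse_pair F G"
    using assms by (auto simp: Aut_su_def pm_invertible_iff)
  then obtain \<delta> H where F: "H \<in> comp_closure elementary_maps" "F = pm_comp H (diag_x \<delta>)"
    using automorphism_tame unfolding tame_def by blast
  have "jac F = cst \<delta>"
    using F by (simp add: jac_comp) (simp add: jac_def diag_x_def dx_simps dx_mult)
  then have "bcoeff (jac F) 0 0 = \<delta>" by (simp add: bcoeff_cst)
  moreover have "jacobian_at F 0 = mat 1" using assms by (simp add: Aut_su_def)
  then have "beval (bpderiv j (F $ i)) 0 = (if i = j then 1 else 0)" for i j
    by (simp add: vec_eq_iff jacobian_at_def jacobian_matrix_def mat_def)
  from this[of 1 1] this[of 1 2] this[of 2 1] this[of 2 2]
  have "bcoeff (jac F) 0 0 = 1"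
    by (simp add: beval_0 bpderiv_def jac_def bcoeff_def coeff_mult)
  ultimately have "diag_x \<delta> = pm_id" by (simp add: diag_x_def pm_id_eq)
  then show ?thesis
    using F comp_closure_mono[OF _ elementary_maps_subset_PF] by simp
qed

text \<open>Terms of degree at least 2 contribute neither to the value nor to the first derivatives
  at the origin.\<close>

lemma vanishing_order_Aut_su:
  fixes H :: "'a::field polymap"
  assumes "pm_invertible (pm_id + H)" "\<And>i. vanishing_order_ge 2 (H $ i)"
  shows "pm_id + H \<in> Aut_su"
proof -
  have zero: "bcoeff (H $ i) k l = 0" if "k + l < 2" for i k l
    using assms(2)[of i] that by (force simp: vanishing_order_ge_def)
  have "pm_eval (pm_id + H) 0 = 0"
    using zero by (simp add: vec_eq_iff forall_2 pm_eval_def beval_0 bcoeff_add pm_id_eq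
        bcoeff_vx bcoeff_vy)
  moreover have "jacobian_at (pm_id + H) 0 = mat 1"
    using zero[of 1 0] zero[of 0 1]
    by (simp add: vec_eq_iff forall_2 jacobian_at_def jacobian_matrix_def mat_def beval_0
        bpderiv_def pm_id_eq dx_simps pderiv_add bcoeff_add)
      (simp add: bcoeff_def coeff_map_poly coeff_pderiv)
  ultimately show ?thesis using assms(1) by (simp add: Aut_su_def)
qed

theorem corollary11:
  shows "(Aut_su :: ('a::field) polymap set) \<subseteq> comp_closure PF
    \<and> (\<forall>F H :: 'a polymap.
         pm_invertible F \<and> F = pm_id + H \<and> (\<forall>i. vanishing_order_ge 2 (H $ i))
           \<longrightarrow> F \<in> comp_closure PF)"
  using Aut_su_closure vanishing_order_Aut_su by blast

end
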